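(* Let $k$ be an algebraically closed field of characteristic zero, $n\ge 2$, $V$ a finite-dimensional $k$-vector space, $g\in\mathrm{GL}(V)$ semisimple, $c\in k^\times$, and let $\rho=\rho_{g,c}$ be the representation of $F_n\rtimes B_n$ on $V$ with $\rho(x_j)=g$ for all $1\le j\le n$ and $\rho(\sigma_i)=cI$ for all $1\le i\le n-1$. Let $\lambda\in k^\times\setminus\{1\}$. (i) If $\mathrm{spec}(g)\subseteq\{1,\mu\}$ for some $\mu\in k^\times\setminus\{1,-1\}$, then the operators $\rho^{\mathrm{KLM}}_\lambda(\sigma_i)$ satisfy $$(T-c)(T+c\mu)=0,$$ and $\sigma_i\mapsto c^{-1}\rho^{\mathrm{KLM}}_\lambda(\sigma_i)$ defines a representation of the Iwahori--Hecke algebra $H_n(\mu)$. (ii) Conversely, suppose that for some $\lambda\in k^\times\setminus\{1\}$ the KLM quotient $V^{\oplus n}/(K+L)$ is nonzero and the operators $\rho^{\mathrm{KLM}}_\lambda(\sigma_i)$ have a quadratic minimal polynomial with two distinct roots. If $n\ge3$, then $\mathrm{spec}(g)\subseteq\{1,\mu\}$ for some $\mu\in k^\times\setminus\{1,-1\}$; since this condition does not involve $\lambda$, the conclusion of (i) then holds for every $\lambda\in k^\times\setminus\{1\}$. If $n=2$, the same conclusion holds when $\lambda$ is nonresonant (that is, $\lambda\nu^2\ne1$ for all $\nu\in\mathrm{spec}(g)$), and exactly one further family appears when $\lambda$ is resonant: if $\lambda\nu_0^2=1$ for some $\nu_0\in\mathrm{spec}(g)$, then $\mathrm{spec}(g)\setminus\{1\}=\{\nu,-\nu\}$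 with $\lambda=\nu^{-2}$ for some $\nu\in k^\times$; and conversely, for $n=2$, whenever $\mathrm{spec}(g)\setminus\{1\}=\{\nu,-\nu\}$ and $\lambda=\nu^{-2}\neq 1$, the operator $\rho^{\mathrm{KLM}}_\lambda(\sigma_1)$ does have a quadratic minimal polynomial with two distinct roots.
   Context: $B_n$ is the Artin braid group with standard generators $\sigma_1,\dots,\sigma_{n-1}$; $F_n$ is the free group on $x_1,\dots,x_n$. The Artin action $\theta\colon B_n\to\mathrm{Aut}(F_n)$ is $\theta_{\sigma_i}(x_i)=x_{i+1}$, $\theta_{\sigma_i}(x_{i+1})=x_{i+1}^{-1}x_ix_{i+1}$, $\theta_{\sigma_i}(x_j)=x_j$ for $j\ne i,i+1$. $F_n\rtimes B_n$ is the corresponding semidirect product, in which $\sigma x\sigma^{-1}=\theta_\sigma(x)$. For a representation $\rho\colon F_n\rtimes B_n\to\mathrm{GL}(V)$, $N=\dim V$, write $g_i:=\rho(x_i)$, $s_i:=\rho(\sigma_i)$. Twisted Long--Moody construction: for $\lambda\in k^\times$, $\rho^{\mathrm{LM}}_\lambda\colon F_n\rtimes B_n\to\mathrm{GL}(V^{\oplus n})$ is the representation given on generators as follows, in $n\times n$ block form with $N\times N$ blocks. $\rho^{\mathrm{LM}}_\lambda(x_i)$ is the identity matrix except in the $i$-th block row, which equals $(\lambda(g_1-1),\dots,\lambda(g_{i-1}-1),\lambda g_i,g_{i+1}-1,\dots,g_n-1)$. $\rho^{\mathrm{LM}}_\lambda(\sigma_i)=s_i^{\oplus n}\cdot\mathrm{diag}(I_{N(i-1)},R_i,I_{N(n-i-1)})$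 with $R_i=\begin{pmatrix}O&g_i\\ I_N&I_N-g_{i+1}\end{pmatrix}$ in block rows and columns $i,i+1$. Katz--Long--Moody (KLM) construction: let $K=\{(w_1,\dots,w_n)^T: w_j\in\mathrm{Ker}(g_j-1)\}$ and $L=\bigcap_{j=1}^n\mathrm{Ker}(\rho^{\mathrm{LM}}_\lambda(x_j)-I)$. The subspace $K+L$ is $\rho^{\mathrm{LM}}_\lambda$-invariant, and $\rho^{\mathrm{KLM}}_\lambda$ is the induced representation of $F_n\rtimes B_n$ on $V^{\oplus n}/(K+L)$. For $q\in k^\times$, $H_n(q)$ is the $k$-algebra with generators $T_1,\dots,T_{n-1}$, the braid relations, and $(T_i-1)(T_i+q)=0$. $\mathrm{spec}(g)$ denotes the set of eigenvalues of $g$. *)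

theory Defs
  imports
    "HOL-Algebra.Bij"
    "HOL-Algebra.Module"
    "HOL-Algebra.QuotRing"
    "HOL-Computational_Algebra.Polynomial"
    "HOL-Library.Poly_Mapping"
begin

section \<open>Groups given by generators and relations\<close>

text \<open>A letter \<open>(a, True)\<close> stands for the generator \<open>a\<close> and \<open>(a, False)\<close> for its formal inverse.
  \<open>pres_cong S R\<close> is the congruence on the words over \<open>S\<close> generated by the relations
  \<open>R\<close> (pairs of words to be identified) and by free cancellation.\<close>

inductive pres_cong ::
    "'a set \<Rightarrow> (('a \<times> bool) list \<times> ('a \<times> bool) list) set \<Rightarrow>
      ('a \<times> bool) list \<Rightarrow> ('a \<times> bool) list \<Rightarrow> bool"
  for S R where
    refl: "w \<in> lists (S \<times> UNIV) \<Longrightarrow> pres_cong S R w w"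
  | sym: "pres_cong S R u v \<Longrightarrow> pres_cong S R v u"
  | trans: "pres_cong S R u v \<Longrightarrow> pres_cong S R v w \<Longrightarrow> pres_cong S R u w"
  | append: "pres_cong S R u v \<Longrightarrow> pres_cong S R u' v' \<Longrightarrow> pres_cong S R (u @ u') (v @ v')"
  | cancel: "a \<in> S \<Longrightarrow> pres_cong S R [(a, b), (a, \<not> b)] []"
  | rel: "(u, v) \<in> R \<Longrightarrow> pres_cong S R u v"

definition pres_class ::
    "'a set \<Rightarrow> (('a \<times> bool) list \<times> ('a \<times> bool) list) set \<Rightarrow> ('a \<times> bool) list \<Rightarrow> ('a \<times> bool) list set"
  where "pres_class S R w = {v. pres_cong S R w v}"

definition pres_group ::
    "'a set \<Rightarrow> (('a \<times> bool) list \<times> ('a \<times> bool) list) set \<Rightarrow> ('a \<times> bool) list set monoid"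
  where "pres_group S R =
    \<lparr>carrier = pres_class S R ` lists (S \<times> UNIV),
     monoid.mult = (\<lambda>X Y. \<Union>u\<in>X. \<Union>v\<in>Y. pres_class S R (u @ v)),
     one = pres_class S R []\<rparr>"

text \<open>\<open>pres_lift H f\<close> is the homomorphism from a presented group to \<open>H\<close> determined by the images
  \<open>f a\<close> of the generators \<open>a\<close>, provided that these satisfy the defining relations.\<close>

fun word_eval :: "('h, 'b) monoid_scheme \<Rightarrow> ('a \<Rightarrow> 'h) \<Rightarrow> ('a \<times> bool) list \<Rightarrow> 'h" where
  "word_eval H f [] = \<one>\<^bsub>H\<^esub>"
| "word_eval H f ((a, b) # w) = (if b then f a else inv\<^bsub>H\<^esub> (f a)) \<otimes>\<^bsub>H\<^esub> word_eval H f w"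

definition pres_lift :: "('h, 'b) monoid_scheme \<Rightarrow> ('a \<Rightarrow> 'h) \<Rightarrow> ('a \<times> bool) list set \<Rightarrow> 'h"
  where "pres_lift H f X = the_elem (word_eval H f ` X)"


section \<open>The group $F_n \rtimes B_n$\<close>

definition free_grp :: "nat \<Rightarrow> (nat \<times> bool) list set monoid"
  where "free_grp n = pres_group {1..n} {}"

definition free_gen :: "nat \<Rightarrow> nat \<Rightarrow> (nat \<times> bool) list set"
  where "free_gen n j = pres_class {1..n} {} [(j, True)]"

definition braid_rels :: "nat \<Rightarrow> ((nat \<times> bool) list \<times> (nat \<times> bool) list) set"
  where "braid_rels n =
    {([(i, True), (j, True)], [(j, True), (i, True)]) | i j.
       i \<in> {1..<n} \<and> j \<in> {1..<n} \<and> (i + 2 \<le> j \<or> j + 2 \<le> i)} \<union>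
    {([(i, True), (i + 1, True), (i, True)], [(i + 1, True), (i, True), (i + 1, True)]) | i.
       i \<in> {1..<n} \<and> i + 1 \<in> {1..<n}}"

definition braid_grp :: "nat \<Rightarrow> (nat \<times> bool) list set monoid"
  where "braid_grp n = pres_group {1..<n} (braid_rels n)"

definition braid_gen :: "nat \<Rightarrow> nat \<Rightarrow> (nat \<times> bool) list set"
  where "braid_gen n i = pres_class {1..<n} (braid_rels n) [(i, True)]"

text \<open>\<open>artin_gen n i\<close> is the automorphism $\theta_{\sigma_i}$ of $F_n$, and \<open>artin n\<close> is
  $\theta \colon B_n \to \mathrm{Aut}(F_n)$.\<close>

definition artin_gen :: "nat \<Rightarrow> nat \<Rightarrow> (nat \<times> bool) list set \<Rightarrow> (nat \<times> bool) list set"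
  where "artin_gen n i =
    (\<lambda>X\<in>carrier (free_grp n). pres_lift (free_grp n)
      (\<lambda>j. if j = i then free_gen n (i + 1)
           else if j = i + 1 then
             inv\<^bsub>free_grp n\<^esub> free_gen n (i + 1) \<otimes>\<^bsub>free_grp n\<^esub> free_gen n i \<otimes>\<^bsub>free_grp n\<^esub> free_gen n (i + 1)
           else free_gen n j) X)"

definition artin :: "nat \<Rightarrow> (nat \<times> bool) list set \<Rightarrow> (nat \<times> bool) list set \<Rightarrow> (nat \<times> bool) list set"
  where "artin n = pres_lift (AutoGroup (free_grp n)) (artin_gen n)"

definition semidirect ::
    "('a, 'c) monoid_scheme \<Rightarrow> ('b, 'd) monoid_scheme \<Rightarrow> ('b \<Rightarrow> 'a \<Rightarrow> 'a) \<Rightarrow> ('a \<times> 'b) monoid"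
  where "semidirect H K \<theta> =
    \<lparr>carrier = carrier H \<times> carrier K,
     monoid.mult = (\<lambda>(h, k) (h', k'). (h \<otimes>\<^bsub>H\<^esub> \<theta> k h', k \<otimes>\<^bsub>K\<^esub> k')),
     one = (\<one>\<^bsub>H\<^esub>, \<one>\<^bsub>K\<^esub>)\<rparr>"

type_synonym fb = "(nat \<times> bool) list set \<times> (nat \<times> bool) list set"

definition FB :: "nat \<Rightarrow> fb monoid"
  where "FB n = semidirect (free_grp n) (braid_grp n) (artin n)"

definition FB_x :: "nat \<Rightarrow> nat \<Rightarrow> fb"
  where "FB_x n j = (free_gen n j, \<one>\<^bsub>braid_grp n\<^esub>)"

definition FB_sigma :: "nat \<Rightarrow> nat \<Rightarrow> fb"
  where "FB_sigma n i = (\<one>\<^bsub>free_grp n\<^esub>, braid_gen n i)"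


section \<open>Vector spaces and algebras as records\<close>

text \<open>Vector spaces over the field \<open>'k\<close> and unital associative \<open>'k\<close>-algebras are both represented
  by the record type \<^typ>\<open>('k, 'm) module\<close>, whose scalars are a type; for vector spaces the
  fields \<open>mult\<close> and \<open>one\<close> are irrelevant.\<close>

definition vspace :: "('k \<Rightarrow> 'v \<Rightarrow> 'v) \<Rightarrow> ('k, 'v::ab_group_add) module"
  where "vspace scale =
    \<lparr>carrier = UNIV, monoid.mult = undefined, one = undefined, zero = 0, add = (+), module.smult = scale\<rparr>"

text \<open>$V^{\oplus n}$: the components are indexed by \<open>1, \<dots>, n\<close>, and a vector is extended by \<open>0\<close> to
  all other indices.\<close>

definition dsum :: "nat \<Rightarrow> ('k \<Rightarrow> 'v \<Rightarrow> 'v) \<Rightarrow> ('k, nat \<Rightarrow> 'v::ab_group_add) module"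
  where "dsum n scale =
    \<lparr>carrier = {w. \<forall>j. j \<notin> {1..n} \<longrightarrow> w j = 0}, monoid.mult = undefined, one = undefined,
     zero = (\<lambda>j. 0), add = (\<lambda>v w j. v j + w j), module.smult = (\<lambda>a w j. scale a (w j))\<rparr>"

text \<open>The quotient of a vector space by a subspace, or of an algebra by a two-sided ideal.\<close>

definition quot :: "('k, 'm) module \<Rightarrow> 'm set \<Rightarrow> ('k, 'm set) module"
  where "quot M U =
    ring.extend (M Quot U) (module.fields (\<lambda>a X. \<Union>x\<in>X. U +>\<^bsub>M\<^esub> (a \<odot>\<^bsub>M\<^esub> x)))"

definition End :: "('k, 'm) module \<Rightarrow> ('k, 'm \<Rightarrow> 'm) module"
  where "End M =
    \<lparr>carrier = {f \<in> carrier M \<rightarrow>\<^sub>E carrier M.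
       (\<forall>x\<in>carrier M. \<forall>y\<in>carrier M. f (x \<oplus>\<^bsub>M\<^esub> y) = f x \<oplus>\<^bsub>M\<^esub> f y) \<and>
       (\<forall>a. \<forall>x\<in>carrier M. f (a \<odot>\<^bsub>M\<^esub> x) = a \<odot>\<^bsub>M\<^esub> f x)},
     monoid.mult = compose (carrier M),
     one = (\<lambda>x\<in>carrier M. x),
     zero = (\<lambda>x\<in>carrier M. \<zero>\<^bsub>M\<^esub>),
     add = (\<lambda>f g. \<lambda>x\<in>carrier M. f x \<oplus>\<^bsub>M\<^esub> g x),
     module.smult = (\<lambda>a f. \<lambda>x\<in>carrier M. a \<odot>\<^bsub>M\<^esub> f x)\<rparr>"

definition GL :: "('k, 'm) module \<Rightarrow> ('m \<Rightarrow> 'm) monoid"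
  where "GL M = units_of (End M)"

definition alg_hom :: "('k, 'a) module \<Rightarrow> ('k, 'b) module \<Rightarrow> ('a \<Rightarrow> 'b) set"
  where "alg_hom A B =
    {\<phi> \<in> ring_hom A B. \<forall>a. \<forall>x\<in>carrier A. \<phi> (a \<odot>\<^bsub>A\<^esub> x) = a \<odot>\<^bsub>B\<^esub> \<phi> x}"

definition poly_eval :: "('k::zero, 'a) module \<Rightarrow> 'k poly \<Rightarrow> 'a \<Rightarrow> 'a"
  where "poly_eval A p t =
    finsum A (\<lambda>i. coeff p i \<odot>\<^bsub>A\<^esub> (t [^]\<^bsub>A\<^esub> i)) {..degree p}"

definition is_minimal_poly :: "('k::field, 'a) module \<Rightarrow> 'a \<Rightarrow> 'k poly \<Rightarrow> bool"
  where "is_minimal_poly A t p \<longleftrightarrow>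
    lead_coeff p = 1 \<and> poly_eval A p t = \<zero>\<^bsub>A\<^esub> \<and> (\<forall>q. poly_eval A q t = \<zero>\<^bsub>A\<^esub> \<longrightarrow> p dvd q)"

definition quadratic_minpoly_distinct_roots :: "('k::field, 'a) module \<Rightarrow> 'a \<Rightarrow> bool"
  where "quadratic_minpoly_distinct_roots A t \<longleftrightarrow>
    (\<exists>p. is_minimal_poly A t p \<and> degree p = 2 \<and> card {r. poly p r = 0} = 2)"

definition spec :: "('k \<Rightarrow> 'v \<Rightarrow> 'v) \<Rightarrow> ('v::ab_group_add \<Rightarrow> 'v) \<Rightarrow> 'k set"
  where "spec scale g = {\<nu>. \<exists>v. v \<noteq> 0 \<and> g v = scale \<nu> v}"

text \<open>Semisimplicity: every invariant subspace has an invariant complement.\<close>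

definition semisimple_op :: "('k::field \<Rightarrow> 'v \<Rightarrow> 'v) \<Rightarrow> ('v::ab_group_add \<Rightarrow> 'v) \<Rightarrow> bool"
  where "semisimple_op scale g \<longleftrightarrow>
    (\<forall>W. module.subspace scale W \<and> g ` W \<subseteq> W \<longrightarrow>
      (\<exists>W'. module.subspace scale W' \<and> g ` W' \<subseteq> W' \<and>
         W \<inter> W' = {0} \<and> {w + w' | w w'. w \<in> W \<and> w' \<in> W'} = UNIV))"


section \<open>The Iwahori--Hecke algebra\<close>

text \<open>With concatenation as addition, lists are the free monoid, so that
  \<^typ>\<open>'a list \<Rightarrow>\<^sub>0 'k\<close> with the convolution product is the free associative algebra.\<close>

instantiation list :: (type) monoid_add
begin

definition zero_list_def: "0 = []"

definition plus_list_def: "xs + ys = xs @ ys"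

instance
  by standard (simp_all add: zero_list_def plus_list_def)

end

definition free_alg :: "'a set \<Rightarrow> ('k::ring_1, 'a list \<Rightarrow>\<^sub>0 'k) module"
  where "free_alg S =
    \<lparr>carrier = {f. Poly_Mapping.keys f \<subseteq> lists S}, monoid.mult = (*), one = 1, zero = 0, add = (+),
     module.smult = (\<lambda>a f. Poly_Mapping.single [] a * f)\<rparr>"

abbreviation free_alg_gen :: "'a \<Rightarrow> ('a list \<Rightarrow>\<^sub>0 'k::ring_1)"
  where "free_alg_gen a \<equiv> Poly_Mapping.single [a] 1"

definition hecke_rels :: "nat \<Rightarrow> 'k::field \<Rightarrow> (nat list \<Rightarrow>\<^sub>0 'k) set"
  where "hecke_rels n q =
    {free_alg_gen i * free_alg_gen j - free_alg_gen j * free_alg_gen i | i j.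
       i \<in> {1..<n} \<and> j \<in> {1..<n} \<and> (i + 2 \<le> j \<or> j + 2 \<le> i)} \<union>
    {free_alg_gen i * free_alg_gen (i + 1) * free_alg_gen i
       - free_alg_gen (i + 1) * free_alg_gen i * free_alg_gen (i + 1) | i.
       i \<in> {1..<n} \<and> i + 1 \<in> {1..<n}} \<union>
    {(free_alg_gen i - 1) * (free_alg_gen i + Poly_Mapping.single [] q) | i. i \<in> {1..<n}}"

definition hecke_ideal :: "nat \<Rightarrow> 'k::field \<Rightarrow> (nat list \<Rightarrow>\<^sub>0 'k) set"
  where "hecke_ideal n q = Idl\<^bsub>free_alg {1..<n}\<^esub> (hecke_rels n q)"

definition hecke_alg :: "nat \<Rightarrow> 'k::field \<Rightarrow> ('k, (nat list \<Rightarrow>\<^sub>0 'k) set) module"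
  where "hecke_alg n q = quot (free_alg {1..<n}) (hecke_ideal n q)"

definition hecke_gen :: "nat \<Rightarrow> 'k::field \<Rightarrow> nat \<Rightarrow> (nat list \<Rightarrow>\<^sub>0 'k) set"
  where "hecke_gen n q i = hecke_ideal n q +>\<^bsub>free_alg {1..<n}\<^esub> free_alg_gen i"


section \<open>The twisted Long--Moody and Katz--Long--Moody constructions\<close>

text \<open>\<open>LM_x\<close> and \<open>LM_sigma\<close> are the block matrices of the twisted Long--Moody construction,
  acting on column vectors, written in terms of $g_j$ (\<open>gs j\<close>) and $s_i$ (\<open>s\<close>).\<close>

definition LM_x ::
    "nat \<Rightarrow> ('k \<Rightarrow> 'v \<Rightarrow> 'v) \<Rightarrow> 'k \<Rightarrow> (nat \<Rightarrow> 'v \<Rightarrow> 'v::ab_group_add) \<Rightarrow> nat \<Rightarrow>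
      (nat \<Rightarrow> 'v) \<Rightarrow> (nat \<Rightarrow> 'v)"
  where "LM_x n scale l gs i =
    (\<lambda>w\<in>carrier (dsum n scale). \<lambda>j.
       if j = i then
         (\<Sum>m\<in>{1..<i}. scale l (gs m (w m) - w m)) + scale l (gs i (w i))
           + (\<Sum>m\<in>{i<..n}. gs m (w m) - w m)
       else w j)"

definition LM_sigma ::
    "nat \<Rightarrow> ('k \<Rightarrow> 'v \<Rightarrow> 'v) \<Rightarrow> (nat \<Rightarrow> 'v \<Rightarrow> 'v::ab_group_add) \<Rightarrow> ('v \<Rightarrow> 'v) \<Rightarrow> nat \<Rightarrow>
      (nat \<Rightarrow> 'v) \<Rightarrow> (nat \<Rightarrow> 'v)"
  where "LM_sigma n scale gs s i =
    (\<lambda>w\<in>carrier (dsum n scale). \<lambda>j. s (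
       if j = i then gs i (w (i + 1))
       else if j = i + 1 then w i + (w (i + 1) - gs (i + 1) (w (i + 1)))
       else w j))"

text \<open>An element \<open>(f, b)\<close> of $F_n \rtimes B_n$ is the product of \<open>(f, 1)\<close> and \<open>(1, b)\<close>.\<close>

definition LM ::
    "nat \<Rightarrow> ('k \<Rightarrow> 'v \<Rightarrow> 'v) \<Rightarrow> 'k \<Rightarrow> (fb \<Rightarrow> 'v \<Rightarrow> 'v::ab_group_add) \<Rightarrow>
      fb \<Rightarrow> (nat \<Rightarrow> 'v) \<Rightarrow> (nat \<Rightarrow> 'v)"
  where "LM n scale l \<rho> = (\<lambda>(f, b).
    pres_lift (GL (dsum n scale)) (LM_x n scale l (\<lambda>j. \<rho> (FB_x n j))) f
    \<otimes>\<^bsub>GL (dsum n scale)\<^esub>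
    pres_lift (GL (dsum n scale))
      (\<lambda>i. LM_sigma n scale (\<lambda>j. \<rho> (FB_x n j)) (\<rho> (FB_sigma n i)) i) b)"

definition KLM_K ::
    "nat \<Rightarrow> ('k \<Rightarrow> 'v \<Rightarrow> 'v) \<Rightarrow> (fb \<Rightarrow> 'v \<Rightarrow> 'v::ab_group_add) \<Rightarrow> (nat \<Rightarrow> 'v) set"
  where "KLM_K n scale \<rho> =
    {w \<in> carrier (dsum n scale). \<forall>j\<in>{1..n}. \<rho> (FB_x n j) (w j) = w j}"

definition KLM_L ::
    "nat \<Rightarrow> ('k \<Rightarrow> 'v \<Rightarrow> 'v) \<Rightarrow> 'k \<Rightarrow> (fb \<Rightarrow> 'v \<Rightarrow> 'v::ab_group_add) \<Rightarrow> (nat \<Rightarrow> 'v) set"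
  where "KLM_L n scale l \<rho> =
    {w \<in> carrier (dsum n scale). \<forall>j\<in>{1..n}. LM n scale l \<rho> (FB_x n j) w = w}"

definition KLM_sub ::
    "nat \<Rightarrow> ('k \<Rightarrow> 'v \<Rightarrow> 'v) \<Rightarrow> 'k \<Rightarrow> (fb \<Rightarrow> 'v \<Rightarrow> 'v::ab_group_add) \<Rightarrow> (nat \<Rightarrow> 'v) set"
  where "KLM_sub n scale l \<rho> = KLM_K n scale \<rho> <+>\<^bsub>dsum n scale\<^esub> KLM_L n scale l \<rho>"

definition KLM_space ::
    "nat \<Rightarrow> ('k \<Rightarrow> 'v \<Rightarrow> 'v) \<Rightarrow> 'k \<Rightarrow> (fb \<Rightarrow> 'v \<Rightarrow> 'v::ab_group_add) \<Rightarrow> ('k, (nat \<Rightarrow> 'v) set) module"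
  where "KLM_space n scale l \<rho> = quot (dsum n scale) (KLM_sub n scale l \<rho>)"

text \<open>As \<open>K + L\<close> is invariant, the union below is the single coset of \<open>LM n scale l \<rho> h w\<close>, for
  any \<open>w\<close> in the coset \<open>X\<close>.\<close>

definition KLM ::
    "nat \<Rightarrow> ('k \<Rightarrow> 'v \<Rightarrow> 'v) \<Rightarrow> 'k \<Rightarrow> (fb \<Rightarrow> 'v \<Rightarrow> 'v::ab_group_add) \<Rightarrow>
      fb \<Rightarrow> (nat \<Rightarrow> 'v) set \<Rightarrow> (nat \<Rightarrow> 'v) set"
  where "KLM n scale l \<rho> h =
    (\<lambda>X\<in>carrier (KLM_space n scale l \<rho>).
       \<Union>w\<in>X. KLM_sub n scale l \<rho> +>\<^bsub>dsum n scale\<^esub> LM n scale l \<rho> h w)"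

text \<open>The operators \<open>T = KLM n scale l \<rho> (FB_sigma n i)\<close> satisfy $(T - c)(T + c\mu) = 0$, and
  $T_i \mapsto c^{-1} T$ extends to a representation of $H_n(\mu)$.\<close>

definition KLM_hecke_type ::
    "nat \<Rightarrow> ('k::field \<Rightarrow> 'v \<Rightarrow> 'v) \<Rightarrow> 'k \<Rightarrow> (fb \<Rightarrow> 'v \<Rightarrow> 'v::ab_group_add) \<Rightarrow> 'k \<Rightarrow> 'k \<Rightarrow> bool"
  where "KLM_hecke_type n scale l \<rho> c \<mu> \<longleftrightarrow>
    (let E = End (KLM_space n scale l \<rho>); T = (\<lambda>i. KLM n scale l \<rho> (FB_sigma n i)) in
      (\<forall>i\<in>{1..<n}. T i \<in> carrier E \<and>
         (T i \<ominus>\<^bsub>E\<^esub> c \<odot>\<^bsub>E\<^esub> \<one>\<^bsub>E\<^esub>) \<otimes>\<^bsub>E\<^esub> (T i \<oplus>\<^bsub>E\<^esub> (c * \<mu>) \<odot>\<^bsub>E\<^esub> \<one>\<^bsub>E\<^esub>) = \<zero>\<^bsub>E\<^esub>) \<and>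
      (\<exists>\<Phi>\<in>alg_hom (hecke_alg n \<mu>) E.
         \<forall>i\<in>{1..<n}. \<Phi> (hecke_gen n \<mu> i) = inverse c \<odot>\<^bsub>E\<^esub> T i))"

end

theory Submission
  imports Defs
begin

text \<open>
  Since \<open>g\<close> is semisimple and the field is algebraically closed, \<open>V\<close> is spanned by the eigenvectors
  of \<open>g\<close>, and everything can be read off on the part of $V^{\oplus n}$ with entries in one eigenspace
  of \<open>g\<close>, for an eigenvalue \<open>\<nu>\<close>. There the operator of $\sigma_i$ is \<open>c\<close> times the identity
  outside the components \<open>i\<close> and \<open>i + 1\<close>, and \<open>c\<close> times
  the matrix \<open>M\<close> with rows $(0, \nu)$ and $(1, 1 - \nu)$ on these components, which has the
  characteristic polynomial $(t - 1)(t + \nu)$.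

  The subspace \<open>K\<close> is the whole part for \<open>\<nu> = 1\<close>. Subtracting neighbouring fixed point equations shows
  that the elements of \<open>L\<close> satisfy $w_i = g\,w_{i+1}$ (\<open>L_recurrence\<close>), so that \<open>L\<close> meets the part for
  \<open>\<nu> \<noteq> 1\<close> in vectors $(\nu^{n-1} v, \dots, \nu v, v)$; for $n = 2$ they belong to \<open>L\<close> exactly if
  $\lambda\nu^2 = 1$ (\<open>L_iff_2\<close>). On \<open>L\<close> all $\sigma_i$ act by \<open>c\<close>.

  If \<open>1\<close> and \<open>\<mu>\<close> are the only eigenvalues, then $(\sigma_i - c)(\sigma_i + c\mu)$ maps $V^{\oplus n}$ into
  \<open>K\<close> (\<open>sigma_op_quadratic\<close>). The braid relations hold for the Long--Moody operators already, and the
  universal property of the Hecke algebra (\<open>hecke_alg_lift\<close>) gives the representation.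

  For the converse, each \<open>\<nu> \<noteq> 1\<close> in the spectrum provides the eigenvector $e_1 - e_2$ of
  $\sigma_1$ for $-c\nu$, which is nonzero in the quotient (\<open>e1_minus_e2_notin_U\<close>), and unless $n = 2$ and
  $\lambda\nu^2 = 1$ also an eigenvector for \<open>c\<close> (\<open>eigenvalue_c\<close>). For \<open>\<nu> = - 1\<close> the two eigenvalues
  of \<open>M\<close> coincide and \<open>M\<close> is a Jordan block, which a quadratic polynomial with distinct roots cannot annihilate
  (\<open>minus_one_notin_spec\<close>). Hence there is at most one \<open>\<nu> \<noteq> 1\<close>, unless $n = 2$ and all of them are
  resonant; these are then among the two square roots of $\lambda^{-1}$. Minimality of a quadratic
  polynomial amounts to the operator not being a scalar (\<open>quadratic_minpoly_iff\<close>), which excludes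
  the spectrum \<open>{1}\<close> and a single resonant \<open>\<nu>\<close>. If \<open>\<nu>\<close> and \<open>- \<nu>\<close> are resonant and no
  other eigenvalues except possibly \<open>1\<close> occur, the operator is diagonalizable on the quotient with the two eigenvalues $\pm c\nu$
  (\<open>quadratic_of_resonant\<close>).
\<close>

section \<open>Vector spaces and algebras over a field\<close>

locale scalar_module = abelian_group M for M :: "('k::field, 'm) module" (structure) +
  assumes smult_closed [simp, intro]: "x \<in> carrier M \<Longrightarrow> a \<odot> x \<in> carrier M"
    and smult_l_distr: "x \<in> carrier M \<Longrightarrow> (a + b) \<odot> x = a \<odot> x \<oplus> b \<odot> x"
    and smult_r_distr: "x \<in> carrier M \<Longrightarrow> y \<in> carrier M \<Longrightarrow> a \<odot> (x \<oplus> y) = a \<odot> x \<oplus> a \<odot> y"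
    and smult_assoc: "x \<in> carrier M \<Longrightarrow> (a * b) \<odot> x = a \<odot> (b \<odot> x)"
    and smult_one [simp]: "x \<in> carrier M \<Longrightarrow> 1 \<odot> x = x"
begin

lemma smult_zero_right [simp]: "a \<odot> \<zero> = \<zero>"
proof -
  have "a \<odot> \<zero> \<oplus> a \<odot> \<zero> = a \<odot> \<zero> \<oplus> \<zero>"
    using smult_r_distr[of \<zero> \<zero> a] by simp
  then show ?thesis
    by (simp only: add.l_cancel_one[OF smult_closed smult_closed] zero_closed add.l_cancel_one r_zero smult_closed)
qed

lemma smult_zero_left [simp]: "x \<in> carrier M \<Longrightarrow> 0 \<odot> x = \<zero>"
  using smult_l_distr[of x 0 0] add.l_cancel_one[of "0 \<odot> x" "0 \<odot> x"] by simp

lemma smult_minus_left: "x \<in> carrier M \<Longrightarrow> (- a) \<odot> x = \<ominus> (a \<odot> x)"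
  using smult_l_distr[of x "-a" a] minus_equality[of "(- a) \<odot> x" "a \<odot> x"] by simp

lemma smult_minus_right:
  assumes "x \<in> carrier M"
  shows "a \<odot> (\<ominus> x) = \<ominus> (a \<odot> x)"
  using smult_r_distr[of "\<ominus> x" x a] assms minus_equality[of "a \<odot> (\<ominus> x)" "a \<odot> x"]
  by (simp add: l_neg)

lemma smult_eq_zeroD:
  assumes "a \<odot> x = \<zero>" "x \<in> carrier M" "a \<noteq> 0"
  shows "x = \<zero>"
  using assms smult_assoc[of x "inverse a" a] by simp

end

locale scalar_algebra = ring A + scalar_module A for A :: "('k::field, 'a) module" (structure) +
  assumes smult_mult_left: "x \<in> carrier A \<Longrightarrow> y \<in> carrier A \<Longrightarrow> (a \<odot> x) \<otimes> y = a \<odot> (x \<otimes> y)"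
    and smult_mult_right: "x \<in> carrier A \<Longrightarrow> y \<in> carrier A \<Longrightarrow> x \<otimes> (a \<odot> y) = a \<odot> (x \<otimes> y)"


section \<open>Endomorphism algebras\<close>

lemma End_simps [simp]:
  "monoid.mult (End M) = compose (carrier M)"
  "monoid.one (End M) = (\<lambda>x\<in>carrier M. x)"
  "ring.zero (End M) = (\<lambda>x\<in>carrier M. \<zero>\<^bsub>M\<^esub>)"
  "ring.add (End M) = (\<lambda>f g. \<lambda>x\<in>carrier M. f x \<oplus>\<^bsub>M\<^esub> g x)"
  "module.smult (End M) = (\<lambda>a f. \<lambda>x\<in>carrier M. a \<odot>\<^bsub>M\<^esub> f x)"
  by (simp_all add: End_def)

lemma End_memI:
  assumes "f \<in> extensional (carrier M)"
    and "\<And>x. x \<in> carrier M \<Longrightarrow> f x \<in> carrier M"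
    and "\<And>x y. x \<in> carrier M \<Longrightarrow> y \<in> carrier M \<Longrightarrow> f (x \<oplus>\<^bsub>M\<^esub> y) = f x \<oplus>\<^bsub>M\<^esub> f y"
    and "\<And>a x. x \<in> carrier M \<Longrightarrow> f (a \<odot>\<^bsub>M\<^esub> x) = a \<odot>\<^bsub>M\<^esub> f x"
  shows "f \<in> carrier (End M)"
  using assms by (auto simp: End_def PiE_def)

lemma End_memD:
  assumes "f \<in> carrier (End M)"
  shows "f \<in> extensional (carrier M)"
    and "x \<in> carrier M \<Longrightarrow> f x \<in> carrier M"
    and "x \<in> carrier M \<Longrightarrow> y \<in> carrier M \<Longrightarrow> f (x \<oplus>\<^bsub>M\<^esub> y) = f x \<oplus>\<^bsub>M\<^esub> f y"
    and "x \<in> carrier M \<Longrightarrow> f (a \<odot>\<^bsub>M\<^esub> x) = a \<odot>\<^bsub>M\<^esub> f x"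
  using assms by (auto simp: End_def PiE_def)

lemma End_eqI:
  assumes "f \<in> carrier (End M)" "h \<in> carrier (End M)"
    and "\<And>x. x \<in> carrier M \<Longrightarrow> f x = h x"
  shows "f = h"
  using assms End_memD(1) extensionalityI by metis

context scalar_module
begin

lemma End_zero:
  assumes "f \<in> carrier (End M)"
  shows "f \<zero> = \<zero>"
  using End_memD(4)[OF assms zero_closed, of 0] End_memD(2)[OF assms zero_closed] by simp

lemma End_abelian_group: "abelian_group (End M)"
proof (rule abelian_groupI; (unfold End_simps)?)
  fix f assume f: "f \<in> carrier (End M)"
  have "(\<lambda>x\<in>carrier M. (- 1) \<odot> f x) \<in> carrier (End M)"
    by (rule End_memI)
       (use f in \<open>auto simp: End_memD smult_r_distr mult.commute simp flip: smult_assoc\<close>)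
  moreover have "(\<lambda>x\<in>carrier M. (\<lambda>x\<in>carrier M. (- 1) \<odot> f x) x \<oplus> f x) = (\<lambda>x\<in>carrier M. \<zero>)"
    using f by (intro restrict_ext) (simp add: End_memD smult_minus_left l_neg)
  ultimately show "\<exists>h\<in>carrier (End M). (\<lambda>x\<in>carrier M. h x \<oplus> f x) = (\<lambda>x\<in>carrier M. \<zero>)"
    by blast
next
  fix f assume "f \<in> carrier (End M)"
  then show "(\<lambda>x\<in>carrier M. (\<lambda>x\<in>carrier M. \<zero>) x \<oplus> f x) = f"
    by (intro extensionalityI[of _ "carrier M"]) (auto simp: End_memD)
qed (auto intro!: End_memI restrict_ext simp: End_memD smult_r_distr a_ac)

lemma End_monoid: "Group.monoid (End M)"
proof (rule monoidI; (unfold End_simps)?)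
  fix f assume f: "f \<in> carrier (End M)"
  have "f \<in> carrier M \<rightarrow> carrier M" "f \<in> extensional (carrier M)"
    using f by (auto simp: End_memD)
  then show "compose (carrier M) (\<lambda>x\<in>carrier M. x) f = f"
      and "compose (carrier M) f (\<lambda>x\<in>carrier M. x) = f"
    by (auto simp: Id_compose compose_Id)
next
  fix f g h assume "h \<in> carrier (End M)"
  then show "compose (carrier M) (compose (carrier M) f g) h
      = compose (carrier M) f (compose (carrier M) g h)"
    by (intro compose_assoc[symmetric]) (auto simp: End_memD)
qed (auto intro!: End_memI simp: End_memD compose_eq)

lemma End_ring: "ring (End M)"
proof (rule ringI[OF End_abelian_group End_monoid]; unfold End_simps)
qed (auto intro!: restrict_ext simp: End_memD compose_def)

lemma End_scalar_algebra: "scalar_algebra (End M)"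
proof -
  interpret E: ring "End M" by (rule End_ring)
  show ?thesis
  proof (unfold_locales; (unfold End_simps)?)
    fix f assume "f \<in> carrier (End M)"
    then show "(\<lambda>x\<in>carrier M. 1 \<odot> f x) = f"
      by (intro extensionalityI[of _ "carrier M"]) (auto simp: End_memD)
  qed (auto intro!: End_memI restrict_ext
        simp: End_memD smult_r_distr smult_l_distr compose_def mult.commute
        simp flip: smult_assoc)
qed

lemma GL_group: "group (GL M)"
  unfolding GL_def by (rule monoid.units_group[OF End_monoid])

text \<open>The inverse map need not be known to be linear: the inverse of a linear bijection is linear.\<close>

lemma GL_memI:
  assumes f: "f \<in> carrier (End M)"
    and inv: "\<And>x. x \<in> carrier M \<Longrightarrow> h x \<in> carrier M"
      "\<And>x. x \<in> carrier M \<Longrightarrow> h (f x) = x" "\<And>x. x \<in> carrier M \<Longrightarrow> f (h x) = x"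
  shows "f \<in> carrier (GL M)"
proof -
  have hE: "restrict h (carrier M) \<in> carrier (End M)"
  proof (rule End_memI)
    fix x y assume x: "x \<in> carrier M" and y: "y \<in> carrier M"
    have "h (x \<oplus> y) = h (f (h x) \<oplus> f (h y))"
      using inv x y by simp
    also have "\<dots> = h (f (h x \<oplus> h y))"
      using End_memD(3)[OF f] inv x y by simp
    also have "\<dots> = h x \<oplus> h y"
      using inv x y by simp
    finally show "restrict h (carrier M) (x \<oplus> y) = restrict h (carrier M) x \<oplus> restrict h (carrier M) y"
      using x y by simp
  next
    fix a x assume x: "x \<in> carrier M"
    have "h (a \<odot> x) = h (f (a \<odot> h x))"
      using End_memD(4)[OF f] inv x by simp
    then show "restrict h (carrier M) (a \<odot> x) = a \<odot> restrict h (carrier M) x"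
      using inv x by simp
  qed (use inv in auto)
  have "restrict h (carrier M) \<otimes>\<^bsub>End M\<^esub> f = \<one>\<^bsub>End M\<^esub>"
       "f \<otimes>\<^bsub>End M\<^esub> restrict h (carrier M) = \<one>\<^bsub>End M\<^esub>"
    using inv End_memD(2)[OF f] by (auto simp: compose_def intro!: restrict_ext)
  then show ?thesis
    using f hE by (auto simp: GL_def units_of_def Units_def)
qed

end


section \<open>Quadratic minimal polynomials\<close>

context scalar_module
begin

lemma End_pow_closed:
  assumes "T \<in> carrier (End M)"
  shows "T [^]\<^bsub>End M\<^esub> (i::nat) \<in> carrier (End M)"
  by (rule monoid.nat_pow_closed[OF End_monoid assms])

lemma finsum_End_apply:
  assumes "finite I" "\<And>i. i \<in> I \<Longrightarrow> F i \<in> carrier (End M)" "x \<in> carrier M"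
  shows "finsum (End M) F I x = (\<Oplus>i\<in>I. F i x)"
  using assms
proof (induction I)
  case empty
  interpret E: scalar_algebra "End M" by (rule End_scalar_algebra)
  show ?case using empty E.finsum_empty by simp
next
  case (insert i I)
  interpret E: scalar_algebra "End M" by (rule End_scalar_algebra)
  have "finsum (End M) F (insert i I) = F i \<oplus>\<^bsub>End M\<^esub> finsum (End M) F I"
    using insert by (intro E.finsum_insert) (simp_all add: Pi_iff)
  then show ?case
    using insert by (subst finsum_insert) (auto simp: End_memD)
qed

lemma poly_eval_closed:
  assumes "T \<in> carrier (End M)"
  shows "poly_eval (End M) p T \<in> carrier (End M)"
proof -
  interpret E: scalar_algebra "End M" by (rule End_scalar_algebra)
  show ?thesis
    unfolding poly_eval_def
    by (intro E.finsum_closed) (use End_pow_closed[OF assms] E.smult_closed in blast)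
qed

lemma poly_eval_apply:
  assumes "T \<in> carrier (End M)" "x \<in> carrier M"
  shows "poly_eval (End M) p T x = (\<Oplus>i\<in>{..degree p}. coeff p i \<odot> (T [^]\<^bsub>End M\<^esub> i) x)"
proof -
  interpret E: scalar_algebra "End M" by (rule End_scalar_algebra)
  show ?thesis
    unfolding poly_eval_def using assms End_pow_closed[OF assms(1)] E.smult_closed
    by (subst finsum_End_apply) auto
qed

lemma poly_eval_eigenvector:
  assumes T: "T \<in> carrier (End M)" and x: "x \<in> carrier M" and eig: "T x = r \<odot> x"
  shows "poly_eval (End M) p T x = poly p r \<odot> x"
proof -
  have pow: "(T [^]\<^bsub>End M\<^esub> i) x = (r ^ i) \<odot> x" for i :: nat
  proof (induction i)
    case (Suc i)
    have "(T [^]\<^bsub>End M\<^esub> Suc i) x = (T [^]\<^bsub>End M\<^esub> i) (T x)"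
      using x by (simp add: compose_eq)
    also have "\<dots> = r \<odot> (T [^]\<^bsub>End M\<^esub> i) x"
      unfolding eig by (rule End_memD(4)[OF End_pow_closed[OF T] x])
    finally show ?case
      using Suc smult_assoc[OF x, of r "r ^ i"] by simp
  qed (use x in simp)
  have "(\<Oplus>i\<in>{..m}. coeff p i \<odot> ((r ^ i) \<odot> x)) = (\<Sum>i\<le>m. coeff p i * r ^ i) \<odot> x" for m :: nat
    using x by (induction m) (auto simp: smult_assoc smult_l_distr a_comm)
  then show ?thesis
    using poly_eval_apply[OF T x, of p] by (simp add: pow poly_altdef)
qed

lemma poly_eval_degree1:
  assumes T: "T \<in> carrier (End M)" and x: "x \<in> carrier M"
  shows "poly_eval (End M) [:b, 1:] T x = b \<odot> x \<oplus> T x"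
proof -
  have "{..degree [:b, 1:]} = {..Suc 0}" by auto
  then show ?thesis
    using poly_eval_apply[OF T x, of "[:b, 1:]"] T x End_memD(2)[OF End_pow_closed[OF T] x]
    by (simp add: compose_eq End_memD a_comm)
qed

lemma poly_eval_degree2:
  assumes T: "T \<in> carrier (End M)" and x: "x \<in> carrier M"
  shows "poly_eval (End M) [:b, a, 1:] T x = b \<odot> x \<oplus> a \<odot> T x \<oplus> T (T x)"
proof -
  have "{..degree [:b, a, 1:]} = {..Suc (Suc 0)}" by auto
  then show ?thesis
    using poly_eval_apply[OF T x, of "[:b, a, 1:]"] T x End_memD(2)[OF End_pow_closed[OF T] x]
    by (simp add: compose_eq End_memD a_ac)
qed

text \<open>A monic quadratic polynomial with distinct roots that annihilates \<open>T\<close> is minimal exactly when no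
  polynomial of degree one annihilates \<open>T\<close>, that is, when \<open>T\<close> is not a scalar: if \<open>T - b\<close> is not
  zero, then its image contains an eigenvector for the other root, so that both roots are roots of
  every annihilating polynomial.\<close>

lemma quadratic_minpoly_iff:
  assumes T: "T \<in> carrier (End M)"
  shows "quadratic_minpoly_distinct_roots (End M) T \<longleftrightarrow>
    (\<exists>r1 r2. r1 \<noteq> r2 \<and>
       (\<forall>x\<in>carrier M. (r1 * r2) \<odot> x \<oplus> (- (r1 + r2)) \<odot> T x \<oplus> T (T x) = \<zero>) \<and>
       \<not> (\<exists>r. \<forall>x\<in>carrier M. T x = r \<odot> x))" (is "?L \<longleftrightarrow> ?R")
proof
  assume ?L
  then obtain p where p: "is_minimal_poly (End M) T p" "degree p = 2" "card {r. poly p r = 0} = 2"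
    unfolding quadratic_minpoly_distinct_roots_def by blast
  from p(3) obtain r1 r2 where r: "{r. poly p r = 0} = {r1, r2}" "r1 \<noteq> r2"
    by (meson card_2_iff)
  from r(1) have "poly p r1 = 0" "poly p r2 = 0" by blast+
  have "[:- r1, 1:] dvd p"
    using \<open>poly p r1 = 0\<close> by (simp add: poly_eq_0_iff_dvd)
  then obtain q where q: "p = [:- r1, 1:] * q" by (rule dvdE)
  have "q \<noteq> 0" using q p(2) by auto
  then have "degree q = 1"
    using p(2) unfolding q by (subst (asm) degree_mult_eq) auto
  moreover have "lead_coeff q = 1"
    using p(1) q unfolding is_minimal_poly_def by (simp only: lead_coeff_mult) simp
  ultimately obtain s where s: "q = [:s, 1:]"
    by (elim degree1_coeffs) auto
  have "s = - r2"
  proof -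
    have "(r2 - r1) * (s + r2) = poly p r2"
      by (simp add: q s algebra_simps)
    then show ?thesis
      using \<open>poly p r2 = 0\<close> r(2) by (simp add: eq_neg_iff_add_eq_0)
  qed
  then have p_eq: "p = [:r1 * r2, - (r1 + r2), 1:]"
    by (simp add: q s)
  have p_zero: "poly_eval (End M) p T = \<zero>\<^bsub>End M\<^esub>"
    using p(1) unfolding is_minimal_poly_def by blast
  have "(r1 * r2) \<odot> x \<oplus> (- (r1 + r2)) \<odot> T x \<oplus> T (T x) = \<zero>" if "x \<in> carrier M" for x
    using poly_eval_degree2[OF T that, of "r1 * r2" "- (r1 + r2)"] p_zero that
    unfolding p_eq by simp
  moreover have "\<not> (\<exists>r. \<forall>x\<in>carrier M. T x = r \<odot> x)"
  proof
    assume "\<exists>r. \<forall>x\<in>carrier M. T x = r \<odot> x"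
    then obtain t where t: "\<And>x. x \<in> carrier M \<Longrightarrow> T x = t \<odot> x" by blast
    have "poly_eval (End M) [:- t, 1:] T = \<zero>\<^bsub>End M\<^esub>"
    proof (rule End_eqI[OF poly_eval_closed[OF T]])
      show "\<zero>\<^bsub>End M\<^esub> \<in> carrier (End M)"
        using abelian_group.axioms(1)[OF End_abelian_group] abelian_monoid.zero_closed by blast
      fix x assume x: "x \<in> carrier M"
      then show "poly_eval (End M) [:- t, 1:] T x = \<zero>\<^bsub>End M\<^esub> x"
        using poly_eval_degree1[OF T x, of "- t"] t[OF x] by (simp add: smult_minus_left l_neg)
    qed
    then have "p dvd [:- t, 1:]"
      using p(1) unfolding is_minimal_poly_def by blast
    then show False
      using dvd_imp_degree_le[of p "[:- t, 1:]"] p(2) by simp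
  qed
  ultimately show ?R using r(2) by blast
next
  assume ?R
  then obtain r1 r2 where r: "r1 \<noteq> r2"
    and quad: "\<And>x. x \<in> carrier M \<Longrightarrow> (r1 * r2) \<odot> x \<oplus> (- (r1 + r2)) \<odot> T x \<oplus> T (T x) = \<zero>"
    and nscalar: "\<And>r. \<exists>x\<in>carrier M. T x \<noteq> r \<odot> x"
    by blast
  \<comment> \<open>The image of \<open>T - b\<close> is nonzero and consists of eigenvectors for the other root \<open>a\<close>.\<close>
  have eigen: "\<exists>y\<in>carrier M. y \<noteq> \<zero> \<and> T y = a \<odot> y"
    if ab: "a * b = r1 * r2" "a + b = r1 + r2" for a b
  proof -
    from nscalar[of b] obtain x where x: "x \<in> carrier M" "T x \<noteq> b \<odot> x" by blast
    define y where "y = T x \<oplus> (- b) \<odot> x"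
    have cl: "T x \<in> carrier M" "T (T x) \<in> carrier M"
      using T x by (auto simp: End_memD)
    have "y \<in> carrier M" unfolding y_def using x cl by simp
    moreover have "y \<noteq> \<zero>"
      using x cl minus_equality[of "T x" "\<ominus> (b \<odot> x)"]
      unfolding y_def by (auto simp: smult_minus_left)
    moreover have "T y = a \<odot> y"
    proof -
      have "T (T x) = \<ominus> ((a * b) \<odot> x \<oplus> (- (a + b)) \<odot> T x)"
        using quad[OF x(1)] x cl unfolding ab
        by (intro minus_equality[symmetric]) (simp_all add: a_comm)
      also have "\<dots> = (- (a * b)) \<odot> x \<oplus> (a + b) \<odot> T x"
        using x cl by (simp add: minus_add add.commute flip: smult_minus_left)
      finally have "T (T x) = (- (a * b)) \<odot> x \<oplus> (a + b) \<odot> T x" .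
      then have "T y = (- (a * b)) \<odot> x \<oplus> (a + b) \<odot> T x \<oplus> (- b) \<odot> T x"
        using T x cl unfolding y_def by (simp add: End_memD)
      also have "\<dots> = (- (a * b)) \<odot> x \<oplus> a \<odot> T x"
        using x cl smult_l_distr[of "T x" "a + b" "- b"] by (simp add: a_assoc)
      also have "\<dots> = a \<odot> y"
        using x cl unfolding y_def by (simp add: smult_r_distr a_comm flip: smult_assoc)
      finally show ?thesis .
    qed
    ultimately show ?thesis by blast
  qed
  have root: "poly q a = 0"
    if q: "poly_eval (End M) q T = \<zero>\<^bsub>End M\<^esub>" and ab: "a * b = r1 * r2" "a + b = r1 + r2" for q a b
  proof -
    obtain y where y: "y \<in> carrier M" "y \<noteq> \<zero>" "T y = a \<odot> y"
      using eigen[OF ab] by blast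
    have "poly q a \<odot> y = \<zero>"
      using poly_eval_eigenvector[OF T y(1,3), of q] q y(1) by simp
    then show ?thesis using y smult_eq_zeroD by blast
  qed
  define p where "p = [:r1 * r2, - (r1 + r2), 1:]"
  have p_fact: "p = [:- r1, 1:] * [:- r2, 1:]"
    by (simp add: p_def)
  have "poly_eval (End M) p T = \<zero>\<^bsub>End M\<^esub>"
  proof (rule End_eqI[OF poly_eval_closed[OF T]])
    show "\<zero>\<^bsub>End M\<^esub> \<in> carrier (End M)"
      using abelian_group.axioms(1)[OF End_abelian_group] abelian_monoid.zero_closed by blast
    fix x assume "x \<in> carrier M"
    then show "poly_eval (End M) p T x = \<zero>\<^bsub>End M\<^esub> x"
      unfolding p_def using poly_eval_degree2[OF T] quad by simp
  qed
  moreover have "p dvd q" if q: "poly_eval (End M) q T = \<zero>\<^bsub>End M\<^esub>" for q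
  proof -
    have roots: "poly q r1 = 0" "poly q r2 = 0"
      using root[OF q, of r1 r2] root[OF q, of r2 r1] by (simp_all add: mult.commute add.commute)
    then obtain q' where q': "q = [:- r1, 1:] * q'"
      by (metis poly_eq_0_iff_dvd dvdE)
    with roots(2) r have "poly q' r2 = 0" by simp
    then obtain q'' where "q' = [:- r2, 1:] * q''"
      by (metis poly_eq_0_iff_dvd dvdE)
    then have "q = p * q''"
      unfolding p_fact q' by (simp only: mult.assoc)
    then show ?thesis by simp
  qed
  moreover have "{r. poly p r = 0} = {r1, r2}"
    unfolding p_fact poly_mult by auto
  ultimately show ?L
    unfolding quadratic_minpoly_distinct_roots_def is_minimal_poly_def using r
    by (intro exI[of _ p]) (auto simp: p_def)
qed

end

section \<open>Quotient spaces and induced endomorphisms\<close>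

locale linear_subspace = scalar_module M for M :: "('k::field, 'm) module" (structure) +
  fixes U
  assumes U_subset: "U \<subseteq> carrier M"
    and U_zero: "\<zero> \<in> U"
    and U_add: "x \<in> U \<Longrightarrow> y \<in> U \<Longrightarrow> x \<oplus> y \<in> U"
    and U_smult: "x \<in> U \<Longrightarrow> a \<odot> x \<in> U"
begin

lemma U_minus: "x \<in> U \<Longrightarrow> \<ominus> x \<in> U"
  using U_smult[of x "- 1"] U_subset by (auto simp: smult_minus_left)

lemma abelian_subgroup_U: "abelian_subgroup U M"
proof (rule abelian_subgroupI3)
  show "additive_subgroup U M"
    by (rule additive_subgroup.intro, rule add.subgroupI)
       (use U_subset U_zero U_add U_minus in \<open>auto simp: a_inv_def[symmetric]\<close>)
  show "abelian_group M" by (rule abelian_group_axioms)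
qed

sublocale U: abelian_subgroup U M
  by (rule abelian_subgroup_U)

lemma coset_eq_iff:
  assumes "x \<in> carrier M" "y \<in> carrier M"
  shows "U +> x = U +> y \<longleftrightarrow> x \<ominus> y \<in> U"
proof
  assume "U +> x = U +> y"
  then have "x \<in> U +> y" using U.a_rcos_self assms by blast
  then show "x \<ominus> y \<in> U" using U.a_rcos_module_imp assms by (simp add: a_minus_def)
next
  assume "x \<ominus> y \<in> U"
  then have "x \<in> U +> y" using U.a_rcos_module_rev assms by (simp add: a_minus_def)
  then show "U +> x = U +> y"
    using U.a_repr_independence'[OF _ assms(2)] by metis
qed

lemma coset_zero: "U +> \<zero> = U"
  using U_subset by (simp add: a_coset_add_zero)

lemma quot_simps [simp]:
  "carrier (quot M U) = (\<lambda>x. U +> x) ` carrier M"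
  "ring.zero (quot M U) = U"
  "ring.add (quot M U) = set_add M"
  by (auto simp: quot_def ring.defs module.defs FactRing_def A_RCOSETS_def' a_r_coset_def r_coset_def
      RCOSETS_def)

lemma coset_memD: "y \<in> U +> x \<Longrightarrow> x \<in> carrier M \<Longrightarrow> y \<in> carrier M \<and> U +> y = U +> x"
  using U.a_elemrcos_carrier[of x y] U.a_repr_independence'[of y x] by simp

lemma UN_coset_const:
  assumes "x \<in> carrier M" "\<And>y. y \<in> carrier M \<Longrightarrow> U +> y = U +> x \<Longrightarrow> F y = B"
  shows "(\<Union>y\<in>U +> x. F y) = B"
proof (rule SUP_eq_const)
  show "U +> x \<noteq> {}" using U.a_rcos_self[OF assms(1)] by blast
  show "F y = B" if "y \<in> U +> x" for y
    using assms(2) coset_memD[OF that assms(1)] by blast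
qed

lemma quot_smult:
  assumes x: "x \<in> carrier M"
  shows "a \<odot>\<^bsub>quot M U\<^esub> (U +> x) = U +> (a \<odot> x)"
proof -
  have "a \<odot>\<^bsub>quot M U\<^esub> (U +> x) = (\<Union>y\<in>U +> x. U +> (a \<odot> y))"
    by (simp add: quot_def ring.defs module.defs)
  also have "\<dots> = U +> (a \<odot> x)"
  proof (rule UN_coset_const[OF x])
    fix y assume y: "y \<in> carrier M" "U +> y = U +> x"
    then have "a \<odot> (y \<ominus> x) \<in> U" using coset_eq_iff x U_smult by blast
    moreover have "a \<odot> (y \<ominus> x) = a \<odot> y \<ominus> a \<odot> x"
      using x y smult_minus_right[of x a] by (simp add: a_minus_def smult_r_distr)
    ultimately show "U +> (a \<odot> y) = U +> (a \<odot> x)"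
      using coset_eq_iff x y by simp
  qed
  finally show ?thesis .
qed

lemma quot_scalar_module: "scalar_module (quot M U)"
proof -
  have "abelian_group (quot M U)"
  proof (rule abelian_groupI)
    fix X assume "X \<in> carrier (quot M U)"
    then obtain x where x: "x \<in> carrier M" "X = U +> x" by auto
    then have "(U +> \<ominus> x) \<oplus>\<^bsub>quot M U\<^esub> X = \<zero>\<^bsub>quot M U\<^esub>"
      by (simp add: U.a_rcos_sum l_neg coset_zero)
    then show "\<exists>Y\<in>carrier (quot M U). Y \<oplus>\<^bsub>quot M U\<^esub> X = \<zero>\<^bsub>quot M U\<^esub>"
      using x by auto
  next
    fix X assume "X \<in> carrier (quot M U)"
    then obtain x where x: "x \<in> carrier M" "X = U +> x" by auto
    then have "(U +> \<zero>) <+> (U +> x) = U +> x" using U.a_rcos_sum[of \<zero> x] by simp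
    then show "\<zero>\<^bsub>quot M U\<^esub> \<oplus>\<^bsub>quot M U\<^esub> X = X"
      using x coset_zero by simp
  next
    show "\<zero>\<^bsub>quot M U\<^esub> \<in> carrier (quot M U)"
      using coset_zero by (auto intro!: image_eqI[of _ _ \<zero>])
  qed (auto simp: U.a_rcos_sum a_ac)
  then interpret Q: abelian_group "quot M U" .
  show ?thesis
    by unfold_locales
       (auto simp: quot_smult U.a_rcos_sum smult_l_distr smult_r_distr smult_assoc)
qed

text \<open>The union is over a family with a single member when \<open>S\<close> is an endomorphism of \<open>M\<close> that
  preserves \<open>U\<close>; then this is the endomorphism of the quotient \<open>M / U\<close> induced by \<open>S\<close>.\<close>

definition induced :: "('m \<Rightarrow> 'm) \<Rightarrow> 'm set \<Rightarrow> 'm set"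
  where "induced S = (\<lambda>X\<in>carrier (quot M U). \<Union>w\<in>X. U +> S w)"

lemma induced_coset:
  assumes S: "S \<in> carrier (End M)" "S ` U \<subseteq> U" and x: "x \<in> carrier M"
  shows "induced S (U +> x) = U +> S x"
proof -
  have "(\<Union>w\<in>U +> x. U +> S w) = U +> S x"
  proof (rule UN_coset_const[OF x])
    fix y assume y: "y \<in> carrier M" "U +> y = U +> x"
    define u where "u = y \<ominus> x"
    have u: "u \<in> U" using y x coset_eq_iff u_def by blast
    then have uc: "u \<in> carrier M" using U_subset by blast
    have "y = u \<oplus> x"
      unfolding u_def using x y by (simp add: a_minus_def a_assoc l_neg)
    then have "S y = S u \<oplus> S x"
      using S uc x by (simp add: End_memD)
    then have "S y \<ominus> S x = S u"
      using S(1) uc x by (simp add: End_memD a_minus_def a_assoc r_neg)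
    then have "S y \<ominus> S x \<in> U" using S(2) u by auto
    then show "U +> S y = U +> S x"
      using S(1) x y coset_eq_iff by (simp add: End_memD)
  qed
  then show ?thesis using x by (simp add: induced_def)
qed

lemma induced_closed:
  assumes S: "S \<in> carrier (End M)" "S ` U \<subseteq> U"
  shows "induced S \<in> carrier (End (quot M U))"
proof (rule End_memI)
  show "induced S \<in> extensional (carrier (quot M U))"
    by (simp add: induced_def del: quot_simps)
  fix X assume X: "X \<in> carrier (quot M U)"
  then obtain x where x: "x \<in> carrier M" "X = U +> x" by auto
  show "induced S X \<in> carrier (quot M U)"
    using x S by (auto simp: induced_coset End_memD)
  show "induced S (a \<odot>\<^bsub>quot M U\<^esub> X) = a \<odot>\<^bsub>quot M U\<^esub> induced S X" for a
    using x S by (simp add: induced_coset End_memD quot_smult)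
  fix Y assume "Y \<in> carrier (quot M U)"
  then obtain y where y: "y \<in> carrier M" "Y = U +> y" by auto
  show "induced S (X \<oplus>\<^bsub>quot M U\<^esub> Y) = induced S X \<oplus>\<^bsub>quot M U\<^esub> induced S Y"
    using x y S by (simp add: induced_coset End_memD U.a_rcos_sum)
qed

lemma coset_eq_zero_iff: "x \<in> carrier M \<Longrightarrow> U +> x = U \<longleftrightarrow> x \<in> U"
  using coset_eq_iff[of x \<zero>] coset_zero minus_equality[of \<zero> \<zero>] by (simp add: a_minus_def)

lemma quadratic_minpoly_induced_iff:
  assumes S: "S \<in> carrier (End M)" "S ` U \<subseteq> U"
  shows "quadratic_minpoly_distinct_roots (End (quot M U)) (induced S) \<longleftrightarrow>
    (\<exists>r1 r2. r1 \<noteq> r2 \<and>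
       (\<forall>x\<in>carrier M. (r1 * r2) \<odot> x \<oplus> (- (r1 + r2)) \<odot> S x \<oplus> S (S x) \<in> U) \<and>
       \<not> (\<exists>r. \<forall>x\<in>carrier M. S x \<oplus> (- r) \<odot> x \<in> U))"
proof -
  interpret Q: scalar_module "quot M U" by (rule quot_scalar_module)
  have all: "(\<forall>X\<in>carrier (quot M U). P X) \<longleftrightarrow> (\<forall>x\<in>carrier M. P (U +> x))" for P
    by simp
  have quad: "(r1 * r2) \<odot>\<^bsub>quot M U\<^esub> (U +> x) \<oplus>\<^bsub>quot M U\<^esub> (- (r1 + r2)) \<odot>\<^bsub>quot M U\<^esub> induced S (U +> x)
      \<oplus>\<^bsub>quot M U\<^esub> induced S (induced S (U +> x)) = \<zero>\<^bsub>quot M U\<^esub>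
    \<longleftrightarrow> (r1 * r2) \<odot> x \<oplus> (- (r1 + r2)) \<odot> S x \<oplus> S (S x) \<in> U" if "x \<in> carrier M" for x r1 r2
    using that S by (simp add: induced_coset End_memD quot_smult U.a_rcos_sum coset_eq_zero_iff)
  have scal: "induced S (U +> x) = r \<odot>\<^bsub>quot M U\<^esub> (U +> x) \<longleftrightarrow> S x \<oplus> (- r) \<odot> x \<in> U"
    if "x \<in> carrier M" for x r
    using that S
    by (simp add: induced_coset End_memD quot_smult coset_eq_iff a_minus_def smult_minus_left)
  show ?thesis
    unfolding Q.quadratic_minpoly_iff[OF induced_closed[OF S]] all
    by (simp only: quad scal cong: ball_cong)
qed

lemma induced_mult:
  assumes "S \<in> carrier (End M)" "S ` U \<subseteq> U" "S' \<in> carrier (End M)" "S' ` U \<subseteq> U"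
  shows "induced S \<otimes>\<^bsub>End (quot M U)\<^esub> induced S' = induced (S \<otimes>\<^bsub>End M\<^esub> S')"
proof -
  interpret Q: scalar_module "quot M U" by (rule quot_scalar_module)
  interpret E: scalar_algebra "End M" by (rule End_scalar_algebra)
  interpret EQ: scalar_algebra "End (quot M U)" by (rule Q.End_scalar_algebra)
  have SS': "S \<otimes>\<^bsub>End M\<^esub> S' \<in> carrier (End M)"
    by (rule E.m_closed[OF assms(1,3)])
  have SS'_U: "(S \<otimes>\<^bsub>End M\<^esub> S') ` U \<subseteq> U"
  proof (rule image_subsetI)
    fix u assume u: "u \<in> U"
    then have "u \<in> carrier M" using U_subset by blast
    then have "(S \<otimes>\<^bsub>End M\<^esub> S') u = S (S' u)" by (simp add: compose_eq)
    then show "(S \<otimes>\<^bsub>End M\<^esub> S') u \<in> U" using u assms(2,4) by blast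
  qed
  show ?thesis
  proof (rule End_eqI[OF EQ.m_closed[OF induced_closed induced_closed] induced_closed[OF SS' SS'_U]])
    fix X assume X: "X \<in> carrier (quot M U)"
    then obtain x where x: "x \<in> carrier M" "X = U +> x" by auto
    have "(induced S \<otimes>\<^bsub>End (quot M U)\<^esub> induced S') X = induced S (induced S' X)"
      using X by (simp add: compose_eq del: quot_simps)
    also have "\<dots> = induced (S \<otimes>\<^bsub>End M\<^esub> S') X"
      unfolding x(2) using assms x(1) induced_coset[OF SS' SS'_U x(1)]
      by (simp add: induced_coset End_memD compose_eq)
    finally show "(induced S \<otimes>\<^bsub>End (quot M U)\<^esub> induced S') X = induced (S \<otimes>\<^bsub>End M\<^esub> S') X" .
  qed (use assms in auto)
qed

lemma induced_quadratic:
  assumes S: "S \<in> carrier (End M)" "S ` U \<subseteq> U"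
    and quad: "\<And>x. x \<in> carrier M \<Longrightarrow> S (S x \<oplus> b \<odot> x) \<oplus> (- a) \<odot> (S x \<oplus> b \<odot> x) \<in> U"
  defines "E \<equiv> End (quot M U)"
  shows "(induced S \<ominus>\<^bsub>E\<^esub> a \<odot>\<^bsub>E\<^esub> \<one>\<^bsub>E\<^esub>) \<otimes>\<^bsub>E\<^esub> (induced S \<oplus>\<^bsub>E\<^esub> b \<odot>\<^bsub>E\<^esub> \<one>\<^bsub>E\<^esub>) = \<zero>\<^bsub>E\<^esub>"
proof -
  interpret Q: scalar_module "quot M U" by (rule quot_scalar_module)
  interpret E: scalar_algebra E unfolding E_def by (rule Q.End_scalar_algebra)
  have T: "induced S \<in> carrier E" unfolding E_def by (rule induced_closed[OF S])
  have minus: "induced S \<ominus>\<^bsub>E\<^esub> a \<odot>\<^bsub>E\<^esub> \<one>\<^bsub>E\<^esub> = induced S \<oplus>\<^bsub>E\<^esub> (- a) \<odot>\<^bsub>E\<^esub> \<one>\<^bsub>E\<^esub>"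
    by (simp add: a_minus_def E.smult_minus_left)
  have shift: "(induced S \<oplus>\<^bsub>E\<^esub> r \<odot>\<^bsub>E\<^esub> \<one>\<^bsub>E\<^esub>) (U +> x) = U +> (S x \<oplus> r \<odot> x)"
    if "x \<in> carrier M" for x r
    using that S by (simp add: E_def induced_coset quot_smult U.a_rcos_sum End_memD)
  show ?thesis
    unfolding minus
  proof (rule End_eqI[of _ "quot M U", folded E_def])
    fix X assume X: "X \<in> carrier (quot M U)"
    then obtain x where x: "x \<in> carrier M" "X = U +> x" by auto
    let ?y = "S x \<oplus> b \<odot> x"
    have y: "?y \<in> carrier M" using x S by (simp add: End_memD)
    have "((induced S \<oplus>\<^bsub>E\<^esub> (- a) \<odot>\<^bsub>E\<^esub> \<one>\<^bsub>E\<^esub>) \<otimes>\<^bsub>E\<^esub> (induced S \<oplus>\<^bsub>E\<^esub> b \<odot>\<^bsub>E\<^esub> \<one>\<^bsub>E\<^esub>)) X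
        = (induced S \<oplus>\<^bsub>E\<^esub> (- a) \<odot>\<^bsub>E\<^esub> \<one>\<^bsub>E\<^esub>) ((induced S \<oplus>\<^bsub>E\<^esub> b \<odot>\<^bsub>E\<^esub> \<one>\<^bsub>E\<^esub>) X)"
      using X unfolding E_def End_simps(1) by (rule compose_eq)
    also have "\<dots> = U +> (S ?y \<oplus> (- a) \<odot> ?y)"
      unfolding x(2) shift[OF x(1)] shift[OF y] ..
    also have "\<dots> = U"
      using quad[OF x(1)] U.a_rcos_const by blast
    finally show "((induced S \<oplus>\<^bsub>E\<^esub> (- a) \<odot>\<^bsub>E\<^esub> \<one>\<^bsub>E\<^esub>) \<otimes>\<^bsub>E\<^esub> (induced S \<oplus>\<^bsub>E\<^esub> b \<odot>\<^bsub>E\<^esub> \<one>\<^bsub>E\<^esub>)) X = \<zero>\<^bsub>E\<^esub> X"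
      using X unfolding E_def by simp
  qed (use T in auto)
qed

end

section \<open>The free algebra and its universal property\<close>

lemma free_alg_simps [simp]:
  "carrier (free_alg S) = {f. Poly_Mapping.keys f \<subseteq> lists S}"
  "monoid.mult (free_alg S) = (*)"
  "monoid.one (free_alg S) = 1"
  "ring.zero (free_alg S) = 0"
  "ring.add (free_alg S) = (+)"
  "module.smult (free_alg S) = (\<lambda>a f. Poly_Mapping.single [] a * f)"
  by (simp_all add: free_alg_def)

lemma keys_add_subset:
  "Poly_Mapping.keys f \<subseteq> B \<Longrightarrow> Poly_Mapping.keys g \<subseteq> B \<Longrightarrow> Poly_Mapping.keys (f + g) \<subseteq> B"
  using keys_add[of f g] by blast

lemma keys_diff_subset:
  fixes f g :: "'a \<Rightarrow>\<^sub>0 'b::cancel_comm_monoid_add"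
  shows "Poly_Mapping.keys f \<subseteq> B \<Longrightarrow> Poly_Mapping.keys g \<subseteq> B \<Longrightarrow> Poly_Mapping.keys (f - g) \<subseteq> B"
  using keys_diff[of f g] by blast

lemma keys_mult_lists:
  assumes "Poly_Mapping.keys f \<subseteq> lists S" "Poly_Mapping.keys g \<subseteq> lists S"
  shows "Poly_Mapping.keys (f * g) \<subseteq> lists S"
  using keys_mult[of f g] assms unfolding plus_list_def by fastforce

lemma keys_single_lists: "w \<in> lists S \<Longrightarrow> Poly_Mapping.keys (Poly_Mapping.single w a) \<subseteq> lists S"
  by (auto simp: keys_single split: if_splits)

lemma keys_one_lists: "Poly_Mapping.keys (1 :: 'a list \<Rightarrow>\<^sub>0 'k::zero_neq_one) \<subseteq> lists S"
  by (simp add: zero_list_def)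

lemma single_Nil_mult:
  "Poly_Mapping.single [] a * (Poly_Mapping.single w b :: 'a list \<Rightarrow>\<^sub>0 'k::semiring_0)
    = Poly_Mapping.single w (a * b)"
  by (simp add: mult_single plus_list_def)

text \<open>Linear extension: an additive property of the elements supported on \<open>B\<close> need only be checked on
  the multiples of the basis elements from \<open>B\<close>.\<close>

lemma poly_mapping_add_induct [consumes 1, case_names zero single add]:
  fixes f :: "'a \<Rightarrow>\<^sub>0 'k::ab_group_add"
  assumes f: "Poly_Mapping.keys f \<subseteq> B"
    and zero: "P 0"
    and single: "\<And>w a. w \<in> B \<Longrightarrow> P (Poly_Mapping.single w a)"
    and add: "\<And>f g. Poly_Mapping.keys f \<subseteq> B \<Longrightarrow> Poly_Mapping.keys g \<subseteq> B \<Longrightarrow> P f \<Longrightarrow> P g \<Longrightarrow> P (f + g)"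
  shows "P f"
proof -
  have "P h" if "finite C" "C \<subseteq> B" "Poly_Mapping.keys h \<subseteq> C" for C h
    using that
  proof (induction C arbitrary: h)
    case empty
    then show ?case using zero by simp
  next
    case (insert w C)
    define r where "r = h - Poly_Mapping.single w (Poly_Mapping.lookup h w)"
    have r: "Poly_Mapping.keys r \<subseteq> C"
      using insert.prems(2) unfolding r_def
      by (auto simp: in_keys_iff lookup_minus lookup_single when_def subset_iff)
    have "P (r + Poly_Mapping.single w (Poly_Mapping.lookup h w))"
      using r insert by (intro add insert.IH single) (auto simp: keys_single)
    then show ?case by (simp add: r_def)
  qed
  from this[OF finite_keys f subset_refl] show ?thesis .
qed

text \<open>The empty word is the unit of the free monoid, so that its multiples are the scalars.\<close>

lemma single_Nil_central:
  fixes f :: "'a list \<Rightarrow>\<^sub>0 'k::field"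
  shows "f * Poly_Mapping.single [] a = Poly_Mapping.single [] a * f"
proof -
  have "Poly_Mapping.keys f \<subseteq> UNIV" by simp
  then show ?thesis
    by (induction f rule: poly_mapping_add_induct)
       (simp_all add: mult_single plus_list_def mult.commute distrib_left distrib_right)
qed

lemma free_alg_scalar_algebra: "scalar_algebra (free_alg S :: ('k::field, 'a list \<Rightarrow>\<^sub>0 'k) module)"
proof -
  let ?F = "free_alg S :: ('k, 'a list \<Rightarrow>\<^sub>0 'k) module"
  have "abelian_group ?F"
  proof (rule abelian_groupI)
    fix f assume "f \<in> carrier ?F"
    then show "\<exists>h\<in>carrier ?F. h \<oplus>\<^bsub>?F\<^esub> f = \<zero>\<^bsub>?F\<^esub>"
      using keys_diff_subset[of 0 "lists S" f] by (intro bexI[of _ "- f"]) simp_all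
  qed (auto simp: keys_add_subset add_ac)
  moreover have "Group.monoid ?F"
    by (rule monoidI) (simp_all add: keys_mult_lists keys_one_lists mult.assoc del: keys_one)
  ultimately have "ring ?F"
    by (rule ringI) (simp_all add: algebra_simps)
  then interpret F: ring ?F .
  have one: "Poly_Mapping.single [] (1::'k) = (1 :: 'a list \<Rightarrow>\<^sub>0 'k)"
    using single_one[where 'a = "'a list" and 'b = 'k] by (simp only: zero_list_def)
  show ?thesis
  proof unfold_locales
    fix f g :: "'a list \<Rightarrow>\<^sub>0 'k" and a b :: 'k
    show "(a * b) \<odot>\<^bsub>?F\<^esub> f = a \<odot>\<^bsub>?F\<^esub> (b \<odot>\<^bsub>?F\<^esub> f)"
      by (simp add: single_Nil_mult flip: mult.assoc)
    show "f \<otimes>\<^bsub>?F\<^esub> (a \<odot>\<^bsub>?F\<^esub> g) = a \<odot>\<^bsub>?F\<^esub> (f \<otimes>\<^bsub>?F\<^esub> g)"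
      by (simp add: single_Nil_central flip: mult.assoc)
  qed (simp_all add: keys_mult_lists keys_single_lists single_add distrib_left distrib_right
        mult.assoc one)
qed

context scalar_algebra
begin

definition word_prod :: "('i \<Rightarrow> 'a) \<Rightarrow> 'i list \<Rightarrow> 'a"
  where "word_prod t w = foldr (\<lambda>i x. t i \<otimes> x) w \<one>"

definition free_lift :: "('i \<Rightarrow> 'a) \<Rightarrow> ('i list \<Rightarrow>\<^sub>0 'k) \<Rightarrow> 'a"
  where "free_lift t f = (\<Oplus>w\<in>Poly_Mapping.keys f. Poly_Mapping.lookup f w \<odot> word_prod t w)"

context
  fixes S :: "'i set" and t
  assumes t [simp]: "\<And>i. i \<in> S \<Longrightarrow> t i \<in> carrier A"
begin

lemma word_prod_closed: "w \<in> lists S \<Longrightarrow> word_prod t w \<in> carrier A"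
  by (induction w) (auto simp: word_prod_def)

lemma word_prod_append:
  "u \<in> lists S \<Longrightarrow> v \<in> lists S \<Longrightarrow> word_prod t (u @ v) = word_prod t u \<otimes> word_prod t v"
proof (induction u)
  case (Cons i u)
  then have "word_prod t u \<in> carrier A" "word_prod t v \<in> carrier A"
    using word_prod_closed by auto
  with Cons show ?case by (simp add: word_prod_def m_assoc)
qed (use word_prod_closed in \<open>simp add: word_prod_def\<close>)

lemma free_lift_superset:
  assumes "finite B" "Poly_Mapping.keys f \<subseteq> B" "B \<subseteq> lists S"
  shows "free_lift t f = (\<Oplus>w\<in>B. Poly_Mapping.lookup f w \<odot> word_prod t w)"
  unfolding free_lift_def
  by (rule add.finprod_mono_neutral_cong_left[OF assms(1,2)])
     (use assms(3) word_prod_closed in \<open>auto simp: in_keys_iff subset_iff\<close>)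

lemma free_lift_closed: "Poly_Mapping.keys f \<subseteq> lists S \<Longrightarrow> free_lift t f \<in> carrier A"
  unfolding free_lift_def by (rule finsum_closed) (use word_prod_closed in \<open>auto simp: subset_iff\<close>)

lemma free_lift_single: "w \<in> lists S \<Longrightarrow> free_lift t (Poly_Mapping.single w a) = a \<odot> word_prod t w"
  using free_lift_superset[of "{w}" "Poly_Mapping.single w a"] word_prod_closed[of w]
  by (simp add: keys_single)

lemma free_lift_add:
  assumes "Poly_Mapping.keys f \<subseteq> lists S" "Poly_Mapping.keys g \<subseteq> lists S"
  shows "free_lift t (f + g) = free_lift t f \<oplus> free_lift t g"
proof -
  let ?B = "Poly_Mapping.keys f \<union> Poly_Mapping.keys g"
  have B: "finite ?B" "?B \<subseteq> lists S" using assms by auto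
  have "free_lift t (f + g) = (\<Oplus>w\<in>?B. Poly_Mapping.lookup (f + g) w \<odot> word_prod t w)"
    using free_lift_superset[OF B(1) keys_add B(2)] .
  also have "\<dots> = (\<Oplus>w\<in>?B. Poly_Mapping.lookup f w \<odot> word_prod t w \<oplus> Poly_Mapping.lookup g w \<odot> word_prod t w)"
    by (rule finsum_cong') (use B word_prod_closed in \<open>auto simp: lookup_add smult_l_distr subset_iff\<close>)
  also have "\<dots> = free_lift t f \<oplus> free_lift t g"
    unfolding free_lift_superset[OF B(1) Un_upper1 B(2)] free_lift_superset[OF B(1) Un_upper2 B(2)]
    by (rule finsum_addf) (use B word_prod_closed in \<open>auto simp: subset_iff\<close>)
  finally show ?thesis .
qed

lemma free_lift_zero: "free_lift t 0 = \<zero>"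
  by (simp add: free_lift_def)

text \<open>Both sides are bilinear in \<open>f\<close> and \<open>g\<close>, and on words the claim is that concatenation
  corresponds to multiplication.\<close>

lemma free_lift_mult:
  assumes f: "Poly_Mapping.keys f \<subseteq> lists S" and g: "Poly_Mapping.keys g \<subseteq> lists S"
  shows "free_lift t (f * g) = free_lift t f \<otimes> free_lift t g"
  using f
proof (induction f rule: poly_mapping_add_induct)
  case zero
  then show ?case by (simp add: free_lift_zero free_lift_closed[OF g])
next
  case (add f f')
  then show ?case
    using g by (simp add: distrib_right free_lift_add keys_mult_lists l_distr free_lift_closed)
next
  case (single u a)
  note u = this
  show ?case using g
  proof (induction g rule: poly_mapping_add_induct)
    case zero
    then show ?case using u by (simp add: free_lift_zero free_lift_closed keys_single_lists)
  next
    case (add g g')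
    then show ?case using u
      by (simp add: distrib_left free_lift_add keys_mult_lists r_distr free_lift_closed
          keys_single_lists)
  next
    case (single v b)
    have "u @ v \<in> lists S" using u single by auto
    then show ?case
      using u single word_prod_closed
      by (simp add: mult_single plus_list_def free_lift_single word_prod_append
          smult_mult_left smult_mult_right mult.commute flip: smult_assoc)
  qed
qed

lemma free_lift_one: "free_lift t 1 = \<one>"
  using free_lift_single[of "[]" 1] single_one[where 'a = "'i list" and 'b = 'k]
  by (simp add: word_prod_def zero_list_def)

lemma free_lift_gen: "i \<in> S \<Longrightarrow> free_lift t (free_alg_gen i) = t i"
  using free_lift_single[of "[i]" 1] by (simp add: word_prod_def)

lemma free_lift_smult:
  assumes "Poly_Mapping.keys f \<subseteq> lists S"
  shows "free_lift t (Poly_Mapping.single [] a * f) = a \<odot> free_lift t f"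
  using assms free_lift_closed[OF assms]
  by (simp add: free_lift_mult keys_single_lists free_lift_single smult_mult_left)
     (simp add: word_prod_def smult_mult_left)

lemma free_lift_ring_hom: "free_lift t \<in> ring_hom (free_alg S) A"
  by (rule ring_hom_memI)
     (simp_all add: free_lift_closed free_lift_mult free_lift_add free_lift_one)

lemma free_lift_diff:
  assumes "Poly_Mapping.keys f \<subseteq> lists S" "Poly_Mapping.keys g \<subseteq> lists S"
  shows "free_lift t (f - g) = free_lift t f \<ominus> free_lift t g"
proof -
  have "free_lift t f = free_lift t (f - g) \<oplus> free_lift t g"
    using free_lift_add[OF keys_diff_subset[OF assms] assms(2)] by simp
  then show ?thesis
    using assms free_lift_closed keys_diff_subset[OF assms]
    by (simp add: a_minus_def a_assoc r_neg)
qed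

end


section \<open>Algebra homomorphisms out of the Iwahori--Hecke algebra\<close>

lemma hecke_rels_subset: "hecke_rels n q \<subseteq> carrier (free_alg {1..<n})"
proof
  fix r assume "r \<in> hecke_rels n q"
  then show "r \<in> carrier (free_alg {1..<n})"
    unfolding hecke_rels_def
    by (elim UnE CollectE exE conjE)
       (simp_all add: keys_diff_subset keys_add_subset keys_mult_lists keys_single_lists
         keys_one_lists del: keys_one keys_single)
qed

text \<open>The lift \<open>free_lift t\<close> to the free algebra kills the defining relations; as its kernel is an
  ideal, it kills the Hecke ideal and is constant on the cosets of that ideal.\<close>

lemma hecke_alg_lift:
  assumes t: "\<And>i. i \<in> {1..<n} \<Longrightarrow> t i \<in> carrier A"
    and comm: "\<And>i j. i \<in> {1..<n} \<Longrightarrow> j \<in> {1..<n} \<Longrightarrow> i + 2 \<le> j \<or> j + 2 \<le> i \<Longrightarrow> t i \<otimes> t j = t j \<otimes> t i"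
    and braid: "\<And>i. i \<in> {1..<n} \<Longrightarrow> i + 1 \<in> {1..<n} \<Longrightarrow>
        t i \<otimes> t (i + 1) \<otimes> t i = t (i + 1) \<otimes> t i \<otimes> t (i + 1)"
    and quad: "\<And>i. i \<in> {1..<n} \<Longrightarrow> (t i \<ominus> \<one>) \<otimes> (t i \<oplus> q \<odot> \<one>) = \<zero>"
  shows "\<exists>\<phi>\<in>alg_hom (hecke_alg n q) A. \<forall>i\<in>{1..<n}. \<phi> (hecke_gen n q i) = t i"
proof -
  define F :: "('k, nat list \<Rightarrow>\<^sub>0 'k) module" where "F = free_alg {1..<n}"
  define \<Psi> where "\<Psi> = free_lift t"
  define I where "I = hecke_ideal n q"
  interpret F: scalar_algebra F unfolding F_def by (rule free_alg_scalar_algebra)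
  have hom: "\<Psi> \<in> ring_hom F A"
    unfolding \<Psi>_def F_def by (rule free_lift_ring_hom[OF t])
  then interpret \<Psi>: ring_hom_ring F A \<Psi>
    by (intro ring_hom_ringI2 F.ring_axioms ring_axioms)
  have gen: "\<Psi> (free_alg_gen i) = t i" if "i \<in> {1..<n}" for i
    unfolding \<Psi>_def by (rule free_lift_gen[OF t that])
  have keys_gen: "Poly_Mapping.keys (Poly_Mapping.single [i] b :: nat list \<Rightarrow>\<^sub>0 'k) \<subseteq> lists {1..<n}"
    if "i \<in> {1..<n}" for i b
    by (rule keys_single_lists) (use that in simp)
  note [simp] = \<Psi>_def free_lift_diff[OF t] free_lift_mult[OF t] free_lift_add[OF t]
    free_lift_gen[OF t] free_lift_one[OF t]
  have rels: "\<Psi> r = \<zero>" if "r \<in> hecke_rels n q" for r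
  proof -
    consider
        (comm) i j where "i \<in> {1..<n}" "j \<in> {1..<n}" "i + 2 \<le> j \<or> j + 2 \<le> i"
          "r = free_alg_gen i * free_alg_gen j - free_alg_gen j * free_alg_gen i"
      | (braid) i where "i \<in> {1..<n}" "i + 1 \<in> {1..<n}"
          "r = free_alg_gen i * free_alg_gen (i + 1) * free_alg_gen i
            - free_alg_gen (i + 1) * free_alg_gen i * free_alg_gen (i + 1)"
      | (quad) i where "i \<in> {1..<n}"
          "r = (free_alg_gen i - 1) * (free_alg_gen i + Poly_Mapping.single [] q)"
      using \<open>r \<in> hecke_rels n q\<close> unfolding hecke_rels_def by blast
    then show ?thesis
    proof cases
      case comm
      note k = keys_gen[OF comm(1), of 1] keys_gen[OF comm(2), of 1]
      have "\<Psi> r = t i \<otimes> t j \<ominus> t j \<otimes> t i"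
        unfolding comm(4) using k keys_mult_lists[OF k] keys_mult_lists[OF k(2,1)] comm(1,2)
        by (simp del: atLeastLessThan_iff)
      then show ?thesis
        using assms(2)[OF comm(1-3)] t comm(1,2) by (simp add: a_minus_def r_neg)
    next
      case braid
      note k = keys_gen[OF braid(1), of 1] keys_gen[OF braid(2), of 1]
      have "\<Psi> r = t i \<otimes> t (i + 1) \<otimes> t i \<ominus> t (i + 1) \<otimes> t i \<otimes> t (i + 1)"
        unfolding braid(3)
        using k keys_mult_lists[OF k] keys_mult_lists[OF k(2,1)] keys_mult_lists[OF keys_mult_lists[OF k] k(1)]
          keys_mult_lists[OF keys_mult_lists[OF k(2,1)] k(2)] braid(1,2)
        by (simp del: atLeastLessThan_iff)
      then show ?thesis
        using assms(3)[OF braid(1,2)] t braid(1,2) by (simp add: a_minus_def r_neg)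
    next
      case quad
      have q: "free_lift t (Poly_Mapping.single [] q) = q \<odot> \<one>"
        using free_lift_single[where S = "{1..<n}" and t = t and w = "[]" and a = q] t
        by (simp add: word_prod_def)
      note k = keys_gen[OF quad(1), of 1] keys_one_lists[of "{1..<n}"]
        keys_single_lists[of "[]" "{1..<n}" q]
      have "\<Psi> r = (t i \<ominus> \<one>) \<otimes> (t i \<oplus> q \<odot> \<one>)"
        unfolding quad(2)
        using k keys_diff_subset[OF k(1,2)] keys_add_subset[OF k(1,3)] quad(1)
        by (simp add: q del: atLeastLessThan_iff)
      then show ?thesis
        using assms(4)[OF quad(1)] by simp
    qed
  qed
  have rels_sub: "hecke_rels n q \<subseteq> carrier F"
    unfolding F_def by (rule hecke_rels_subset)
  have I_ideal: "ideal I F"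
    unfolding I_def hecke_ideal_def using F.genideal_ideal[OF rels_sub] by (simp add: F_def)
  have "hecke_rels n q \<subseteq> a_kernel F A \<Psi>"
    using rels rels_sub by (auto simp: a_kernel_def')
  then have I_ker: "I \<subseteq> a_kernel F A \<Psi>"
    unfolding I_def hecke_ideal_def
    using F.genideal_minimal[OF \<Psi>.kernel_is_ideal] by (simp add: F_def)
  interpret I: ideal I F by (rule I_ideal)
  interpret IS: linear_subspace F I
  proof
    fix f a assume f: "f \<in> I"
    have "Poly_Mapping.single [] a \<in> carrier F"
      by (simp add: F_def keys_single_lists)
    from I.I_l_closed[OF f this] show "a \<odot>\<^bsub>F\<^esub> f \<in> I" by (simp add: F_def)
  qed (use I.a_subset in auto)
  have H: "hecke_alg n q = quot F I"
    by (simp add: hecke_alg_def F_def I_def)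
  have H_mult: "(I +>\<^bsub>F\<^esub> x) \<otimes>\<^bsub>quot F I\<^esub> (I +>\<^bsub>F\<^esub> y) = I +>\<^bsub>F\<^esub> (x \<otimes>\<^bsub>F\<^esub> y)"
    if "x \<in> carrier F" "y \<in> carrier F" for x y
    using I.rcoset_mult_add[OF that]
    by (simp add: quot_def ring.defs module.defs FactRing_def)
  have H_one: "\<one>\<^bsub>quot F I\<^esub> = I +>\<^bsub>F\<^esub> \<one>\<^bsub>F\<^esub>"
    by (simp add: quot_def ring.defs module.defs FactRing_def)
  define \<Phi> where "\<Phi> X = the_elem (\<Psi> ` X)" for X
  have \<Phi>: "\<Phi> (I +>\<^bsub>F\<^esub> x) = \<Psi> x" if x: "x \<in> carrier F" for x
  proof -
    have "\<Psi> y = \<Psi> x" if "y \<in> I +>\<^bsub>F\<^esub> x" for y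
    proof -
      from that obtain h where h: "h \<in> I" "y = h \<oplus>\<^bsub>F\<^esub> x"
        by (auto simp: a_r_coset_def' )
      then have "h \<in> carrier F" "\<Psi> h = \<zero>"
        using I_ker by (auto simp: a_kernel_def')
      then show ?thesis
        unfolding h(2) using x \<Psi>.hom_add[of h x] \<Psi>.hom_closed[OF x] by (simp del: \<Psi>_def)
    qed
    then have "\<Psi> ` (I +>\<^bsub>F\<^esub> x) = {\<Psi> x}"
      using I.a_rcos_self[OF x] by blast
    then show ?thesis by (simp add: \<Phi>_def del: \<Psi>_def)
  qed
  have "\<Phi> \<in> ring_hom (hecke_alg n q) A"
    unfolding H
  proof (rule ring_hom_memI)
    fix X Y assume "X \<in> carrier (quot F I)" "Y \<in> carrier (quot F I)"
    then obtain x y where xy: "x \<in> carrier F" "X = I +>\<^bsub>F\<^esub> x" "y \<in> carrier F" "Y = I +>\<^bsub>F\<^esub> y"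
      by auto
    show "\<Phi> (X \<otimes>\<^bsub>quot F I\<^esub> Y) = \<Phi> X \<otimes> \<Phi> Y"
      using xy \<Psi>.hom_mult[of x y] by (simp add: H_mult \<Phi> del: \<Psi>_def)
    show "\<Phi> (X \<oplus>\<^bsub>quot F I\<^esub> Y) = \<Phi> X \<oplus> \<Phi> Y"
      using xy \<Psi>.hom_add[of x y] by (simp add: I.a_rcos_sum \<Phi> del: \<Psi>_def)
  qed (auto simp: \<Phi> H_one simp del: \<Psi>_def)
  moreover have "\<Phi> (a \<odot>\<^bsub>hecke_alg n q\<^esub> X) = a \<odot> \<Phi> X" if "X \<in> carrier (hecke_alg n q)" for a X
  proof -
    from that obtain x where x: "x \<in> carrier F" "X = I +>\<^bsub>F\<^esub> x"
      unfolding H by auto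
    have "\<Psi> (a \<odot>\<^bsub>F\<^esub> x) = a \<odot> \<Psi> x"
      using x(1) free_lift_smult[where S = "{1..<n}" and t = t and f = x and a = a] t
      by (simp add: F_def)
    then show ?thesis
      unfolding H using x by (simp add: IS.quot_smult \<Phi> del: \<Psi>_def)
  qed
  moreover have "\<Phi> (hecke_gen n q i) = t i" if "i \<in> {1..<n}" for i
  proof -
    have "free_alg_gen i \<in> carrier F"
      using keys_gen[OF that, of 1] by (simp add: F_def)
    then show ?thesis
      using \<Phi> gen[OF that] by (simp add: hecke_gen_def F_def I_def del: \<Psi>_def)
  qed
  ultimately show ?thesis
    unfolding alg_hom_def by blast
qed

end

section \<open>Homomorphisms out of presented groups\<close>

context group
begin

lemma word_eval_closed:
  assumes "f ` S \<subseteq> carrier G" "w \<in> lists (S \<times> UNIV)"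
  shows "word_eval G f w \<in> carrier G"
  using assms(2,1) by (induction w) auto

lemma word_eval_append:
  assumes "f ` S \<subseteq> carrier G" "u \<in> lists (S \<times> UNIV)" "v \<in> lists (S \<times> UNIV)"
  shows "word_eval G f (u @ v) = word_eval G f u \<otimes> word_eval G f v"
  using assms(2,1)
proof (induction u)
  case Nil
  then show ?case using word_eval_closed[OF assms(1,3)] by simp
next
  case (Cons a u)
  then show ?case
    using word_eval_closed[OF assms(1,3)] word_eval_closed[OF assms(1), of u]
    by (cases a) (auto simp: m_assoc)
qed

text \<open>The congruence is the least one that contains the relations and free cancellation, and equality of
  values under \<open>word_eval G f\<close> is such a congruence on the words over \<open>S\<close>, where evaluation
  is multiplicative.\<close>

lemma word_eval_pres_cong:
  assumes "pres_cong S R u v"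
    and f: "f ` S \<subseteq> carrier G"
    and R: "\<And>u v. (u, v) \<in> R \<Longrightarrow> u \<in> lists (S \<times> UNIV) \<and> v \<in> lists (S \<times> UNIV) \<and> word_eval G f u = word_eval G f v"
  shows "u \<in> lists (S \<times> UNIV) \<and> v \<in> lists (S \<times> UNIV) \<and> word_eval G f u = word_eval G f v"
  using assms(1)
proof induction
  case (append u v u' v')
  then show ?case using word_eval_append[OF f] by auto
next
  case (cancel a b)
  then have "f a \<in> carrier G" using f by auto
  then show ?case using cancel by simp
qed (use R in auto)

lemma pres_lift_class:
  assumes f: "f ` S \<subseteq> carrier G"
    and R: "\<And>u v. (u, v) \<in> R \<Longrightarrow> u \<in> lists (S \<times> UNIV) \<and> v \<in> lists (S \<times> UNIV) \<and> word_eval G f u = word_eval G f v"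
    and w: "w \<in> lists (S \<times> UNIV)"
  shows "pres_lift G f (pres_class S R w) = word_eval G f w"
proof -
  have "word_eval G f v = word_eval G f w" if "pres_cong S R w v" for v
    using word_eval_pres_cong[OF that f R] by simp
  then have "word_eval G f ` pres_class S R w = {word_eval G f w}"
    using pres_cong.refl[OF w, of R] unfolding pres_class_def by blast
  then show ?thesis by (simp add: pres_lift_def)
qed

end

section \<open>Semisimple operators are diagonalizable\<close>

context finite_dimensional_vector_space
begin

text \<open>This is $p(g)\,v$.\<close>

definition poly_act :: "('b \<Rightarrow> 'b) \<Rightarrow> 'a poly \<Rightarrow> 'b \<Rightarrow> 'b"
  where "poly_act g p v = (\<Sum>i\<le>degree p. coeff p i *s (g ^^ i) v)"

lemma poly_act_bound:
  assumes "degree p \<le> N"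
  shows "poly_act g p v = (\<Sum>i\<le>N. coeff p i *s (g ^^ i) v)"
  unfolding poly_act_def
  by (rule sum.mono_neutral_left) (use assms in \<open>auto simp: coeff_eq_0\<close>)

lemma poly_act_linear_factor:
  assumes g: "Vector_Spaces.linear scale scale g"
  shows "poly_act g ([:- r, 1:] * q) v = g (poly_act g q v) - r *s poly_act g q v"
proof -
  interpret g: Vector_Spaces.linear scale scale g by (rule g)
  let ?N = "degree q"
  have deg: "degree ([:- r, 1:] * q) \<le> Suc ?N"
    using degree_mult_le[of "[:- r, 1:]" q] by simp
  have co: "coeff ([:- r, 1:] * q) i = coeff (pCons 0 q) i - r * coeff q i" for i
    by simp
  have "poly_act g ([:- r, 1:] * q) v
      = (\<Sum>i\<le>Suc ?N. coeff (pCons 0 q) i *s (g ^^ i) v) - r *s (\<Sum>i\<le>Suc ?N. coeff q i *s (g ^^ i) v)"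
    unfolding poly_act_bound[OF deg] co
    by (simp only: scale_left_diff_distrib sum_subtractf scale_sum_right scale_scale)
  also have "(\<Sum>i\<le>Suc ?N. coeff (pCons 0 q) i *s (g ^^ i) v) = g (poly_act g q v)"
    unfolding sum.atMost_Suc_shift poly_act_def by (simp add: g.sum g.scale)
  also have "(\<Sum>i\<le>Suc ?N. coeff q i *s (g ^^ i) v) = poly_act g q v"
    by (rule poly_act_bound[symmetric]) simp
  finally show ?thesis .
qed

text \<open>The vectors $v, g v, \dots, g^d v$ with $d = \dim V$ cannot be independent; a linear relation
  between them is an annihilating polynomial.\<close>

lemma annihilating_poly:
  "\<exists>p. p \<noteq> 0 \<and> poly_act g p v = 0"
proof (cases "inj_on (\<lambda>i. (g ^^ i) v) {..dimension}")
  case True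
  let ?B = "(\<lambda>i. (g ^^ i) v) ` {..dimension}"
  have "card ?B = Suc dimension"
    using card_image[OF True] by simp
  then have "dependent ?B"
    using independent_card_le_dim[of ?B UNIV] by (fastforce simp: dim_UNIV dimension_def)
  then obtain t u where t: "finite t" "t \<subseteq> ?B" "(\<Sum>w\<in>t. u w *s w) = 0" "\<exists>w\<in>t. u w \<noteq> 0"
    unfolding dependent_explicit by blast
  define p where "p = (\<Sum>i\<in>{..dimension}. monom (if (g ^^ i) v \<in> t then u ((g ^^ i) v) else 0) i)"
  have co: "coeff p i = (if i \<le> dimension \<and> (g ^^ i) v \<in> t then u ((g ^^ i) v) else 0)" for i
    unfolding p_def by (simp add: coeff_sum coeff_monom)
  have "degree p \<le> dimension"
    by (rule degree_le) (simp add: co)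
  then have "poly_act g p v = (\<Sum>i\<le>dimension. (if (g ^^ i) v \<in> t then u ((g ^^ i) v) else 0) *s (g ^^ i) v)"
    by (subst poly_act_bound) (auto simp: co intro!: sum.cong)
  also have "\<dots> = (\<Sum>w\<in>?B. (if w \<in> t then u w else 0) *s w)"
    by (subst sum.reindex[OF True]) simp
  also have "\<dots> = (\<Sum>w\<in>t. u w *s w)"
    by (rule sum.mono_neutral_cong_right) (use t in auto)
  finally have "poly_act g p v = 0" using t by simp
  moreover from t(2,4) obtain i where "i \<le> dimension" "(g ^^ i) v \<in> t" "u ((g ^^ i) v) \<noteq> 0" by blast
  then have "coeff p i \<noteq> 0" by (simp add: co)
  then have "p \<noteq> 0" by auto
  ultimately show ?thesis by blast
next
  \<comment> \<open>Two of the vectors coincide, and the relation between them is \<open>g\<^sup>j v - g\<^sup>i v = 0\<close>.\<close>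
  case False
  then obtain i j where ij: "i < j" "(g ^^ i) v = (g ^^ j) v"
    unfolding inj_on_def by (metis linorder_neqE_nat)
  define p where "p = monom 1 j - monom (1::'a) i"
  have co: "coeff p m = (if m = j then 1 else 0) - (if m = i then 1 else 0)" for m
    unfolding p_def by (simp add: coeff_monom)
  have "degree p \<le> j"
    by (rule degree_le) (use ij in \<open>auto simp: co\<close>)
  then have "poly_act g p v = (\<Sum>m\<le>j. (if m = j then (g ^^ j) v else 0) - (if m = i then (g ^^ i) v else 0))"
    by (subst poly_act_bound) (auto simp: co scale_left_diff_distrib intro!: sum.cong)
  also have "\<dots> = 0"
    using ij by (simp add: sum_subtractf)
  finally have "poly_act g p v = 0" .
  moreover have "coeff p j = 1" using ij by (simp add: co)
  then have "p \<noteq> 0" by auto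
  ultimately show ?thesis by blast
qed

end

text \<open>For an annihilating polynomial of least degree, split off a linear factor \<open>x - r\<close>: the cofactor does
  not annihilate \<open>v\<close>, and what it makes of \<open>v\<close> is an eigenvector for \<open>r\<close>.\<close>

lemma (in finite_dimensional_vector_space) eigenvector_exists:
  assumes g: "Vector_Spaces.linear scale scale g"
    and W: "subspace W" "g ` W \<subseteq> W" "v \<in> W" "v \<noteq> 0"
    and closed: "\<And>p :: 'a poly. degree p > 0 \<Longrightarrow> \<exists>x. poly p x = 0"
  shows "\<exists>r u. u \<in> W \<and> u \<noteq> 0 \<and> g u = r *s u"
proof -
  have pow: "(g ^^ i) v \<in> W" for i
    using W by (induction i) auto
  have act: "poly_act g p v \<in> W" for p
    unfolding poly_act_def using W(1) pow by (intro subspace_sum subspace_scale) auto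
  have "\<exists>r u. u \<in> W \<and> u \<noteq> 0 \<and> g u = r *s u" if "p \<noteq> 0" "poly_act g p v = 0" for p
    using that
  proof (induction "degree p" arbitrary: p rule: less_induct)
    case less
    have "degree p > 0"
    proof (rule ccontr)
      assume "\<not> degree p > 0"
      then have "poly_act g p v = coeff p 0 *s v" "coeff p 0 \<noteq> 0"
        using less(2) by (auto simp: poly_act_def) (metis leading_coeff_0_iff)
      then show False using less(3) W(4) by simp
    qed
    then obtain r where "poly p r = 0" using closed by blast
    then obtain q where q: "p = [:- r, 1:] * q" by (auto simp: poly_eq_0_iff_dvd elim: dvdE)
    have "q \<noteq> 0" using less(2) q by auto
    then have "degree q < degree p" unfolding q by (subst degree_mult_eq) auto
    show ?case
    proof (cases "poly_act g q v = 0")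
      case True
      show ?thesis by (rule less(1)[OF \<open>degree q < degree p\<close> \<open>q \<noteq> 0\<close> True])
    next
      case False
      have "g (poly_act g q v) = r *s poly_act g q v"
        using less(3) unfolding q poly_act_linear_factor[OF g] by simp
      then show ?thesis using False act by blast
    qed
  qed
  then show ?thesis using annihilating_poly by blast
qed

text \<open>The span of the eigenvectors is invariant. An invariant complement contains no eigenvector, so
  that it is zero by \<open>eigenvector_exists\<close>.\<close>

lemma semisimple_eigenvectors_span:
  fixes scale :: "'k::alg_closed_field \<Rightarrow> 'v::ab_group_add \<Rightarrow> 'v"
  assumes V: "finite_dimensional_vector_space scale Basis"
    and g: "Vector_Spaces.linear scale scale g" "semisimple_op scale g"
  shows "module.span scale {v. \<exists>r. g v = scale r v} = UNIV"
proof -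
  interpret finite_dimensional_vector_space scale Basis by (rule V)
  interpret g: Vector_Spaces.linear scale scale g by (rule g)
  define E where "E = {v. \<exists>r. g v = scale r v}"
  have "g v \<in> span E" if "v \<in> span E" for v
    using that
  proof (induction rule: span_induct_alt)
    case (step r u v)
    then obtain s where "g u = scale s u" unfolding E_def by blast
    then show ?case using step by (simp add: g.add g.scale span_add span_scale span_base)
  qed (simp add: g.zero span_zero)
  then have "subspace (span E)" "g ` span E \<subseteq> span E" by auto
  then obtain W where W: "subspace W" "g ` W \<subseteq> W" "span E \<inter> W = {0}"
      "{w + w' | w w'. w \<in> span E \<and> w' \<in> W} = UNIV"
    using g(2) unfolding semisimple_op_def by meson
  have "W = {0}"
  proof (rule ccontr)
    assume "W \<noteq> {0}"
    then obtain v where "v \<in> W" "v \<noteq> 0" using subspace_0[OF W(1)] by blast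
    then obtain r u where u: "u \<in> W" "u \<noteq> 0" "g u = scale r u"
      using eigenvector_exists[OF g(1) W(1,2)] alg_closed_imp_poly_has_root by blast
    then have "u \<in> span E" by (intro span_base) (auto simp: E_def)
    then show False using u W(3) by blast
  qed
  then show ?thesis using W(4) unfolding E_def by auto
qed

section \<open>The Long--Moody operators of a scalar representation\<close>

lemma dsum_simps [simp]:
  "carrier (dsum n scale) = {w. \<forall>j. j \<notin> {1..n} \<longrightarrow> w j = 0}"
  "ring.zero (dsum n scale) = (\<lambda>j. 0)"
  "ring.add (dsum n scale) = (\<lambda>v w j. v j + w j)"
  "module.smult (dsum n scale) = (\<lambda>a w j. scale a (w j))"
  by (simp_all add: dsum_def)

lemma (in vector_space) dsum_scalar_module: "scalar_module (dsum n scale)"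
proof -
  have "abelian_group (dsum n scale)"
  proof (rule abelian_groupI)
    fix w :: "nat \<Rightarrow> 'b" assume "w \<in> carrier (dsum n scale)"
    then show "\<exists>v\<in>carrier (dsum n scale). v \<oplus>\<^bsub>dsum n scale\<^esub> w = \<zero>\<^bsub>dsum n scale\<^esub>"
      by (intro bexI[of _ "\<lambda>j. - w j"]) auto
  qed (auto simp: add_ac)
  then interpret D: abelian_group "dsum n scale" .
  show ?thesis
    by unfold_locales (auto simp: scale_left_distrib scale_right_distrib)
qed

text \<open>The scalar \<open>l\<close> is the twisting parameter $\lambda$.\<close>

locale scalar_rep = finite_dimensional_vector_space scale Basis
  for scale :: "'k::{alg_closed_field, field_char_0} \<Rightarrow> 'v::ab_group_add \<Rightarrow> 'v" (infixr \<open>*s\<close> 75)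
    and Basis +
  fixes n :: nat and g :: "'v \<Rightarrow> 'v" and c :: 'k and \<rho> :: "fb \<Rightarrow> 'v \<Rightarrow> 'v" and l :: 'k
  assumes n: "n \<ge> 2"
    and g_GL: "g \<in> carrier (GL (vspace scale))"
    and g_semisimple: "semisimple_op scale g"
    and c: "c \<noteq> 0"
    and \<rho>_x: "\<And>j. j \<in> {1..n} \<Longrightarrow> \<rho> (FB_x n j) = g"
    and \<rho>_sigma: "\<And>i. i \<in> {1..<n} \<Longrightarrow> \<rho> (FB_sigma n i) = scale c"
    and l: "l \<noteq> 0" "l \<noteq> 1"
begin

abbreviation D where "D \<equiv> dsum n scale"

text \<open>The Long--Moody matrices of $\sigma_i$ and $x_i$, with $g_j = g$ for all indices \<open>j\<close> rather than
  for $1 \le j \le n$ only.\<close>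

definition sigma_op :: "nat \<Rightarrow> (nat \<Rightarrow> 'v) \<Rightarrow> nat \<Rightarrow> 'v"
  where "sigma_op i = LM_sigma n scale (\<lambda>_. g) (scale c) i"

definition x_op :: "nat \<Rightarrow> (nat \<Rightarrow> 'v) \<Rightarrow> nat \<Rightarrow> 'v"
  where "x_op i = LM_x n scale l (\<lambda>_. g) i"

sublocale D: scalar_module D
  by (rule dsum_scalar_module)

lemma g_linear: "Vector_Spaces.linear scale scale g" and g_bij: "bij g"
proof -
  from g_GL obtain h where gh: "g \<in> carrier (End (vspace scale))"
      "h \<otimes>\<^bsub>End (vspace scale)\<^esub> g = \<one>\<^bsub>End (vspace scale)\<^esub>"
      "g \<otimes>\<^bsub>End (vspace scale)\<^esub> h = \<one>\<^bsub>End (vspace scale)\<^esub>"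
    by (auto simp: GL_def units_of_def Units_def simp del: End_simps)
  have "g (x + y) = g x + g y" "g (a *s x) = a *s g x" for x y a
    using End_memD(3,4)[OF gh(1)] by (simp_all add: vspace_def)
  then show "Vector_Spaces.linear scale scale g"
    by unfold_locales
  have "h (g x) = x" "g (h x) = x" for x
    using gh(2,3)[THEN fun_cong, of x] by (simp_all add: vspace_def compose_def)
  then show "bij g" by (intro o_bij[of h g]) (auto simp: fun_eq_iff)
qed

sublocale g: Vector_Spaces.linear scale scale g
  by (rule g_linear)

abbreviation g' where "g' \<equiv> inv_into UNIV g"

lemma g_inv [simp]: "g (g' v) = v" "g' (g v) = v"
  using g_bij by (simp_all add: bij_is_surj surj_f_inv_f bij_is_inj)

lemma spec_nonzero:
  assumes "\<nu> \<in> spec scale g"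
  shows "\<nu> \<noteq> 0"
proof
  assume "\<nu> = 0"
  then obtain v where v: "v \<noteq> 0" "g v = 0"
    using assms unfolding spec_def by auto
  have "v = g' (g v)" by simp
  also have "\<dots> = g' (g 0)" using v(2) by (simp only: g.zero)
  also have "\<dots> = 0" by (rule g_inv(2))
  finally show False using v(1) by contradiction
qed

lemma sigma_op_apply:
  "w \<in> carrier D \<Longrightarrow> sigma_op i w = (\<lambda>j. c *s (if j = i then g (w (i + 1))
     else if j = i + 1 then w i + (w (i + 1) - g (w (i + 1))) else w j))"
  by (simp add: sigma_op_def LM_sigma_def)

lemma sigma_op_End:
  assumes "i \<in> {1..<n}"
  shows "sigma_op i \<in> carrier (End D)"
proof (rule End_memI)
  show "sigma_op i \<in> extensional (carrier D)" by (simp add: sigma_op_def LM_sigma_def)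
  show cl: "sigma_op i w \<in> carrier D" if "w \<in> carrier D" for w
    using that assms by (auto simp: sigma_op_apply)
  show "sigma_op i (v \<oplus>\<^bsub>D\<^esub> w) = sigma_op i v \<oplus>\<^bsub>D\<^esub> sigma_op i w" if "v \<in> carrier D" "w \<in> carrier D" for v w
    using that D.a_closed[OF that]
    by (auto simp: sigma_op_apply g.add algebra_simps scale_right_distrib scale_right_diff_distrib)
  show "sigma_op i (a \<odot>\<^bsub>D\<^esub> w) = a \<odot>\<^bsub>D\<^esub> sigma_op i w" if "w \<in> carrier D" for w a
    using that D.smult_closed[OF that]
    by (auto simp: sigma_op_apply g.scale scale_right_distrib scale_right_diff_distrib mult.commute)
qed

text \<open>With $b = w_{i+1}$ and $a = w_i$, the new components are $c\,g b$ and $c\,(a + b - g b)$; the first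
  one determines \<open>b\<close>, and the sum of both determines \<open>a\<close>.\<close>

lemma sigma_op_GL:
  assumes i: "i \<in> {1..<n}"
  shows "sigma_op i \<in> carrier (GL D)"
proof -
  define h where "h y = (\<lambda>j. inverse c *s (if j = i then y (i + 1) + y i - g' (y i)
     else if j = i + 1 then g' (y i) else y j))" for y :: "nat \<Rightarrow> 'v"
  show ?thesis
  proof (rule D.GL_memI[OF sigma_op_End[OF i], where h = h])
    fix y assume y: "y \<in> carrier D"
    show h: "h y \<in> carrier D"
      using y i by (auto simp: h_def)
    have inv_scale: "g' (a *s v) = a *s g' v" for a v
      by (metis g_inv g.scale)
    show "sigma_op i (h y) = y"
      unfolding sigma_op_apply[OF h] using c
      by (auto simp: h_def g.scale g.add g.diff scale_right_distrib scale_right_diff_distrib)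
    show "h (sigma_op i y) = y"
      unfolding sigma_op_apply[OF y] using c
      by (auto simp: h_def inv_scale scale_right_distrib scale_right_diff_distrib)
  qed
qed

lemma x_op_apply:
  "w \<in> carrier D \<Longrightarrow> x_op i w = w(i := (\<Sum>m\<in>{1..<i}. l *s (g (w m) - w m)) + l *s g (w i)
     + (\<Sum>m\<in>{i<..n}. g (w m) - w m))"
  by (auto simp: x_op_def LM_x_def)

lemma x_op_End:
  assumes "i \<in> {1..n}"
  shows "x_op i \<in> carrier (End D)"
proof (rule End_memI)
  show "x_op i \<in> extensional (carrier D)" by (simp add: x_op_def LM_x_def)
  show cl: "x_op i w \<in> carrier D" if "w \<in> carrier D" for w
    using that assms by (auto simp: x_op_apply)
  show "x_op i (v \<oplus>\<^bsub>D\<^esub> w) = x_op i v \<oplus>\<^bsub>D\<^esub> x_op i w" if "v \<in> carrier D" "w \<in> carrier D" for v w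
  proof -
    have "(\<Sum>m\<in>A. a *s (g (v m + w m) - (v m + w m)))
        = (\<Sum>m\<in>A. a *s (g (v m) - v m)) + (\<Sum>m\<in>A. a *s (g (w m) - w m))" for A :: "nat set" and a
      by (simp add: g.add algebra_simps scale_right_distrib scale_right_diff_distrib sum.distrib
          sum_subtractf)
    from this[of l "{1..<i}"] this[of 1 "{i<..n}"] show ?thesis
      using that D.a_closed[OF that]
      by (simp add: x_op_apply fun_eq_iff g.add scale_right_distrib del: sum.op_ivl_Suc)
  qed
  show "x_op i (a \<odot>\<^bsub>D\<^esub> w) = a \<odot>\<^bsub>D\<^esub> x_op i w" if "w \<in> carrier D" for w a
  proof -
    have "(\<Sum>m\<in>A. b *s (g (a *s w m) - a *s w m)) = a *s (\<Sum>m\<in>A. b *s (g (w m) - w m))"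
      for A :: "nat set" and b
      by (simp add: g.scale scale_sum_right scale_right_diff_distrib mult.commute)
    from this[of l "{1..<i}"] this[of 1 "{i<..n}"] show ?thesis
      using that D.smult_closed[OF that]
      by (simp add: x_op_apply fun_eq_iff g.scale scale_right_distrib mult.commute)
  qed
qed

text \<open>Only the component \<open>i\<close> is changed, by a formula whose dependence on that component is the
  invertible \<open>l *s g\<close>; the remaining summand \<open>A\<close> is unaffected by the change.\<close>

lemma x_op_GL:
  assumes i: "i \<in> {1..n}"
  shows "x_op i \<in> carrier (GL D)"
proof -
  define A where "A w = (\<Sum>m\<in>{1..<i}. l *s (g (w m) - w m)) + (\<Sum>m\<in>{i<..n}. g (w m) - w m)" for w
  have A_upd: "A (w(i := u)) = A w" for w u
    unfolding A_def by (intro arg_cong2[of _ _ _ _ "(+)"] sum.cong) auto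
  have x_op: "x_op i w = w(i := A w + l *s g (w i))" if "w \<in> carrier D" for w
    using that by (simp add: x_op_apply A_def algebra_simps)
  define h where "h y = y(i := inverse l *s g' (y i - A y))" for y
  show ?thesis
  proof (rule D.GL_memI[OF x_op_End[OF i], where h = h])
    fix y assume y: "y \<in> carrier D"
    show h: "h y \<in> carrier D"
      using y i by (auto simp: h_def)
    have inv_scale: "g' (a *s v) = a *s g' v" for a v
      by (metis g_inv g.scale)
    show "x_op i (h y) = y"
      unfolding x_op[OF h] using l by (auto simp: h_def A_upd g.scale)
    show "h (x_op i y) = y"
      unfolding x_op[OF y] using l by (auto simp: h_def A_upd inv_scale)
  qed
qed

section \<open>The braid relations\<close>

lemma sigma_op_comm:
  assumes "i \<in> {1..<n}" "j \<in> {1..<n}" "i + 2 \<le> j \<or> j + 2 \<le> i"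
  shows "sigma_op i \<otimes>\<^bsub>End D\<^esub> sigma_op j = sigma_op j \<otimes>\<^bsub>End D\<^esub> sigma_op i"
  unfolding End_simps(1) compose_def
proof (rule restrict_ext)
  fix w assume w: "w \<in> carrier D"
  have cl: "sigma_op i w \<in> carrier D" "sigma_op j w \<in> carrier D"
    using w assms by (blast intro: End_memD(2)[OF sigma_op_End])+
  show "sigma_op i (sigma_op j w) = sigma_op j (sigma_op i w)"
    unfolding sigma_op_apply[OF cl(1)] sigma_op_apply[OF cl(2)] unfolding sigma_op_apply[OF w] using assms(3)
    by (auto simp: fun_eq_iff g.scale scale_right_distrib scale_right_diff_distrib)
qed

lemma sigma_op_braid:
  assumes "i \<in> {1..<n}" "i + 1 \<in> {1..<n}"
  shows "sigma_op i \<otimes>\<^bsub>End D\<^esub> (sigma_op (i + 1) \<otimes>\<^bsub>End D\<^esub> sigma_op i) = sigma_op (i + 1) \<otimes>\<^bsub>End D\<^esub> (sigma_op i \<otimes>\<^bsub>End D\<^esub> sigma_op (i + 1))"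
proof (unfold End_simps(1), rule extensionalityI[of _ "carrier D"])
  fix w assume w: "w \<in> carrier D"
  have cl: "sigma_op j v \<in> carrier D" if "j \<in> {i, i + 1}" "v \<in> carrier D" for j v
    using that assms by (blast intro: End_memD(2)[OF sigma_op_End])
  have a: "sigma_op i w \<in> carrier D" "sigma_op (i + 1) w \<in> carrier D" "sigma_op (i + 1) (sigma_op i w) \<in> carrier D"
    "sigma_op i (sigma_op (i + 1) w) \<in> carrier D" using cl w by auto
  have "sigma_op i (sigma_op (i + 1) (sigma_op i w)) = sigma_op (i + 1) (sigma_op i (sigma_op (i + 1) w))"
    unfolding sigma_op_apply[OF a(3)] sigma_op_apply[OF a(4)] unfolding sigma_op_apply[OF a(1)] sigma_op_apply[OF a(2)]
    unfolding sigma_op_apply[OF w]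
    by (auto simp: fun_eq_iff g.scale g.add g.diff scale_right_distrib scale_right_diff_distrib
        algebra_simps)
  then show "compose (carrier D) (sigma_op i) (compose (carrier D) (sigma_op (i + 1)) (sigma_op i)) w =
      compose (carrier D) (sigma_op (i + 1)) (compose (carrier D) (sigma_op i) (sigma_op (i + 1))) w"
    using w by (simp add: compose_eq del: dsum_simps)
qed simp_all


section \<open>Values of the Long--Moody representation on the generators\<close>

lemma LM_sigma_eq:
  "i \<in> {1..<n} \<Longrightarrow> LM_sigma n scale (\<lambda>j. \<rho> (FB_x n j)) (\<rho> (FB_sigma n i)) i = sigma_op i"
  unfolding sigma_op_def LM_sigma_def using \<rho>_x[of i] \<rho>_x[of "i + 1"] \<rho>_sigma[of i]
  by (intro restrict_ext ext) simp

lemma LM_x_eq: "i \<in> {1..n} \<Longrightarrow> LM_x n scale l (\<lambda>j. \<rho> (FB_x n j)) i = x_op i"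
  unfolding x_op_def LM_x_def
  by (intro restrict_ext ext) (auto simp: \<rho>_x intro!: sum.cong arg_cong2[of _ _ _ _ "(+)"])

lemma GL_D_simps [simp]: "monoid.mult (GL D) = compose (carrier D)" "\<one>\<^bsub>GL D\<^esub> = (\<lambda>x\<in>carrier D. x)"
  by (simp_all add: GL_def units_of_def)

lemma braid_rels_sigma_op:
  assumes "(u, v) \<in> braid_rels n"
    and f: "\<And>i. i \<in> {1..<n} \<Longrightarrow> f i = sigma_op i"
  shows "u \<in> lists ({1..<n} \<times> UNIV) \<and> v \<in> lists ({1..<n} \<times> UNIV) \<and>
    word_eval (GL D) f u = word_eval (GL D) f v"
proof -
  have id: "compose (carrier D) (sigma_op i) (\<lambda>x\<in>carrier D. x) = sigma_op i" if "i \<in> {1..<n}" for i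
    using monoid.r_one[OF D.End_monoid sigma_op_End[OF that]] by simp
  consider
      (comm) i j where "i \<in> {1..<n}" "j \<in> {1..<n}" "i + 2 \<le> j \<or> j + 2 \<le> i"
        "u = [(i, True), (j, True)]" "v = [(j, True), (i, True)]"
    | (braid) i where "i \<in> {1..<n}" "i + 1 \<in> {1..<n}"
        "u = [(i, True), (i + 1, True), (i, True)]" "v = [(i + 1, True), (i, True), (i + 1, True)]"
    using assms(1) unfolding braid_rels_def by blast
  then show ?thesis
  proof cases
    case comm
    then show ?thesis
      using sigma_op_comm[OF comm(1-3)] by (simp add: f id del: dsum_simps)
  next
    case braid
    then show ?thesis
      using sigma_op_braid[OF braid(1,2)] f[OF braid(1)] f[OF braid(2)] id[OF braid(1)] id[OF braid(2)]
      by (simp del: dsum_simps)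
  qed
qed

text \<open>The value of \<open>pres_lift\<close> on a class is the value on any representative because the operators
  satisfy the braid relations.\<close>

lemma LM_FB_sigma:
  assumes i: "i \<in> {1..<n}"
  shows "LM n scale l \<rho> (FB_sigma n i) = sigma_op i"
proof -
  interpret G: group "GL D" by (rule D.GL_group)
  let ?fs = "\<lambda>i. LM_sigma n scale (\<lambda>j. \<rho> (FB_x n j)) (\<rho> (FB_sigma n i)) i"
  let ?fx = "LM_x n scale l (\<lambda>j. \<rho> (FB_x n j))"
  have fs: "?fs ` {1..<n} \<subseteq> carrier (GL D)"
    using sigma_op_GL by (auto simp: LM_sigma_eq simp del: dsum_simps)
  have fx: "?fx ` {1..n} \<subseteq> carrier (GL D)"
    using x_op_GL by (auto simp: LM_x_eq simp del: dsum_simps)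
  have "pres_lift (GL D) ?fx \<one>\<^bsub>free_grp n\<^esub> = \<one>\<^bsub>GL D\<^esub>"
    using G.pres_lift_class[OF fx, of "{}" "[]"] by (simp add: free_grp_def pres_group_def)
  moreover have "pres_lift (GL D) ?fs (braid_gen n i) = ?fs i \<otimes>\<^bsub>GL D\<^esub> \<one>\<^bsub>GL D\<^esub>"
    unfolding braid_gen_def
    using G.pres_lift_class[OF fs braid_rels_sigma_op[OF _ LM_sigma_eq], of "braid_rels n" "[(i, True)]"] i by simp
  ultimately show ?thesis
    unfolding LM_def FB_sigma_def
    using sigma_op_GL[OF i] LM_sigma_eq[OF i]
    by (simp del: GL_D_simps dsum_simps add: FB_sigma_def)
qed

lemma LM_FB_x:
  assumes j: "j \<in> {1..n}"
  shows "LM n scale l \<rho> (FB_x n j) = x_op j"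
proof -
  interpret G: group "GL D" by (rule D.GL_group)
  let ?fs = "\<lambda>i. LM_sigma n scale (\<lambda>j. \<rho> (FB_x n j)) (\<rho> (FB_sigma n i)) i"
  let ?fx = "LM_x n scale l (\<lambda>j. \<rho> (FB_x n j))"
  have fs: "?fs ` {1..<n} \<subseteq> carrier (GL D)"
    using sigma_op_GL by (auto simp: LM_sigma_eq simp del: dsum_simps)
  have fx: "?fx ` {1..n} \<subseteq> carrier (GL D)"
    using x_op_GL by (auto simp: LM_x_eq simp del: dsum_simps)
  have "pres_lift (GL D) ?fs \<one>\<^bsub>braid_grp n\<^esub> = \<one>\<^bsub>GL D\<^esub>"
    using G.pres_lift_class[OF fs braid_rels_sigma_op[OF _ LM_sigma_eq], of "braid_rels n" "[]"]
    by (simp add: braid_grp_def pres_group_def)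
  moreover have "pres_lift (GL D) ?fx (free_gen n j) = ?fx j \<otimes>\<^bsub>GL D\<^esub> \<one>\<^bsub>GL D\<^esub>"
    unfolding free_gen_def
    using G.pres_lift_class[OF fx, of "{}" "[(j, True)]"] j by simp
  ultimately show ?thesis
    unfolding LM_def FB_x_def
    using x_op_GL[OF j] LM_x_eq[OF j]
    by (simp del: GL_D_simps dsum_simps add: FB_x_def)
qed


section \<open>The Katz--Long--Moody quotient\<close>

abbreviation K where "K \<equiv> KLM_K n scale \<rho>"
abbreviation L where "L \<equiv> KLM_L n scale l \<rho>"
abbreviation U where "U \<equiv> KLM_sub n scale l \<rho>"
abbreviation Q where "Q \<equiv> KLM_space n scale l \<rho>"

lemma K_eq: "K = {w \<in> carrier D. \<forall>j\<in>{1..n}. g (w j) = w j}"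
  unfolding KLM_K_def by (auto simp: \<rho>_x)

lemma L_eq: "L = {w \<in> carrier D. \<forall>j\<in>{1..n}. x_op j w = w}"
  unfolding KLM_L_def by (auto simp: LM_FB_x)

lemma U_eq: "U = {(\<lambda>j. k j + m j) | k m. k \<in> K \<and> m \<in> L}"
  unfolding KLM_sub_def set_add_def' by auto

lemma U_I: "k \<in> K \<Longrightarrow> m \<in> L \<Longrightarrow> (\<lambda>j. k j + m j) \<in> U"
  unfolding U_eq by (rule CollectI) (intro exI conjI; (rule HOL.refl | assumption))

lemma zero_in_K: "(\<lambda>j. 0) \<in> K"
  by (simp add: K_eq g.zero)

lemma zero_in_L: "(\<lambda>j. 0) \<in> L"
  using D.End_zero[OF x_op_End] by (auto simp: L_eq)

lemma K_subset_U: "K \<subseteq> U"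
  using zero_in_L unfolding U_eq by force

lemma L_subset_U: "L \<subseteq> U"
  using zero_in_K unfolding U_eq by force

lemma U_add_closed: "v \<in> U \<Longrightarrow> w \<in> U \<Longrightarrow> (\<lambda>j. v j + w j) \<in> U"
proof -
  assume "v \<in> U" "w \<in> U"
  then obtain k m k' m' where v: "v = (\<lambda>j. k j + m j)" "k \<in> K" "m \<in> L"
    and w: "w = (\<lambda>j. k' j + m' j)" "k' \<in> K" "m' \<in> L"
    unfolding U_eq by blast
  have "(\<lambda>j. k j + k' j) \<in> K"
    using v w by (simp add: K_eq g.add)
  moreover have "(\<lambda>j. m j + m' j) \<in> L"
    using v(3) w(3) End_memD(3)[OF x_op_End, of _ m m'] by (simp add: L_eq)
  moreover have "(\<lambda>j. v j + w j) = (\<lambda>j. (k j + k' j) + (m j + m' j))"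
    unfolding v(1) w(1) by (simp add: add_ac)
  ultimately show "(\<lambda>j. v j + w j) \<in> U"
    by (simp only: U_I)
qed

lemma U_scale_closed: "v \<in> U \<Longrightarrow> (\<lambda>j. a *s v j) \<in> U"
proof -
  assume "v \<in> U"
  then obtain k m where v: "v = (\<lambda>j. k j + m j)" "k \<in> K" "m \<in> L"
    unfolding U_eq by blast
  have "(\<lambda>j. a *s k j) \<in> K"
    using v by (simp add: K_eq g.scale)
  moreover have "(\<lambda>j. a *s m j) \<in> L"
    using v(3) End_memD(4)[OF x_op_End, of _ m a] by (simp add: L_eq)
  moreover have "(\<lambda>j. a *s v j) = (\<lambda>j. a *s k j + a *s m j)"
    unfolding v(1) by (simp add: scale_right_distrib)
  ultimately show "(\<lambda>j. a *s v j) \<in> U"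
    by (simp only: U_I)
qed

lemma U_scale_cancel:
  assumes "(\<lambda>j. a *s v j) \<in> U" "a \<noteq> 0"
  shows "v \<in> U"
  using U_scale_closed[OF assms(1), of "inverse a"] assms(2) by simp

sublocale U: linear_subspace D U
proof
  show "U \<subseteq> carrier D" unfolding U_eq by (auto simp: K_eq L_eq)
  show "\<zero>\<^bsub>D\<^esub> \<in> U" using zero_in_K K_subset_U by auto
qed (simp_all add: U_add_closed U_scale_closed)

text \<open>The fixed point equations for $x_i$ and $x_{i+1}$ share all summands except those for the indices
  \<open>i\<close> and \<open>i + 1\<close>; their difference is $(\lambda - 1)(w_i - g w_{i+1}) = 0$.\<close>

lemma L_recurrence:
  assumes w: "w \<in> L" and i: "i \<in> {1..<n}"
  shows "w i = g (w (i + 1))"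
proof -
  have wD: "w \<in> carrier D" using w by (simp add: L_eq)
  define A where "A = (\<Sum>m\<in>{1..<i}. l *s (g (w m) - w m))"
  define B where "B = (\<Sum>m\<in>{i + 1<..n}. g (w m) - w m)"
  have "{1..<i + 1} = insert i {1..<i}" "{i<..n} = insert (i + 1) {i + 1<..n}"
    using i by auto
  then have sums: "(\<Sum>m\<in>{1..<i + 1}. l *s (g (w m) - w m)) = l *s (g (w i) - w i) + A"
      "(\<Sum>m\<in>{i<..n}. g (w m) - w m) = g (w (i + 1)) - w (i + 1) + B"
    by (simp_all add: A_def B_def)
  have "x_op i w i = w i" "x_op (i + 1) w (i + 1) = w (i + 1)"
    using w i by (auto simp: L_eq)
  then have eqs: "A + l *s g (w i) + (g (w (i + 1)) - w (i + 1) + B) = w i"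
      "l *s (g (w i) - w i) + A + l *s g (w (i + 1)) + B = w (i + 1)"
    unfolding x_op_apply[OF wD] by (simp_all only: fun_upd_same sums A_def[symmetric] B_def[symmetric])
  have "(l - 1) *s (w i - g (w (i + 1))) =
      (A + l *s g (w i) + (g (w (i + 1)) - w (i + 1) + B)) - w i
      - ((l *s (g (w i) - w i) + A + l *s g (w (i + 1)) + B) - w (i + 1))"
    by (simp add: scale_left_diff_distrib scale_right_diff_distrib)
  also have "\<dots> = 0" unfolding eqs by simp
  finally show ?thesis using l by simp
qed

text \<open>The recurrence together with the last fixed point equation describes \<open>L\<close>. On the eigenspace of
  \<open>g\<close> for \<open>\<nu>\<close> the second condition reads $\lambda \nu^2 = 1$, the resonance condition.\<close>

lemma L_iff_2:
  assumes "n = 2"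
  shows "w \<in> L \<longleftrightarrow> w \<in> carrier D \<and> w 1 = g (w 2) \<and> l *s g (g (w 2)) = w 2"
proof (cases "w \<in> carrier D")
  case True
  have sets: "{1..<1::nat} = {}" "{1<..n} = {2}" "{1..<2::nat} = {1}" "{2<..n} = {}" "{1..n} = {1, 2}"
    using assms by auto
  have x1: "x_op 1 w = w \<longleftrightarrow> w 1 = l *s g (w 1) + (g (w 2) - w 2)"
    unfolding x_op_apply[OF True] by (simp add: sets fun_upd_idem_iff del: One_nat_def)
  have x2: "x_op 2 w = w \<longleftrightarrow> w 2 = l *s (g (w 1) - w 1) + l *s g (w 2)"
    unfolding x_op_apply[OF True] by (simp add: sets fun_upd_idem_iff del: One_nat_def)
  show ?thesis
  proof
    assume w: "w \<in> L"
    have "w 1 = g (w 2)"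
      using L_recurrence[OF w, of 1] assms by (simp add: numeral_2_eq_2)
    moreover have "x_op 2 w = w"
      using w unfolding L_eq sets by blast
    ultimately show "w \<in> carrier D \<and> w 1 = g (w 2) \<and> l *s g (g (w 2)) = w 2"
      using True x2 by (simp add: scale_right_diff_distrib)
  next
    assume w: "w \<in> carrier D \<and> w 1 = g (w 2) \<and> l *s g (g (w 2)) = w 2"
    then have "w 1 = l *s g (w 1) + (g (w 2) - w 2)" "w 2 = l *s (g (w 1) - w 1) + l *s g (w 2)"
      by (simp_all add: scale_right_diff_distrib)
    then show "w \<in> L"
      using x1 x2 w unfolding L_eq sets by blast
  qed
qed (simp add: L_eq del: dsum_simps)

lemma sigma_op_on_L:
  assumes w: "w \<in> L" and i: "i \<in> {1..<n}"
  shows "sigma_op i w = (\<lambda>j. c *s w j)"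
proof -
  have "w \<in> carrier D" using w by (simp add: L_eq)
  then show ?thesis
    unfolding sigma_op_apply[OF \<open>w \<in> carrier D\<close>] using L_recurrence[OF w i] by auto
qed

lemma sigma_op_on_K:
  assumes w: "w \<in> K" and i: "i \<in> {1..<n}"
  shows "sigma_op i w \<in> K"
proof -
  have wD: "w \<in> carrier D" using w by (simp add: K_eq)
  then have "sigma_op i w \<in> carrier D" using End_memD(2)[OF sigma_op_End[OF i]] by blast
  then show ?thesis
    using w i unfolding K_eq sigma_op_apply[OF wD] by (auto simp: g.scale g.add g.diff)
qed

lemma sigma_op_U:
  assumes i: "i \<in> {1..<n}"
  shows "sigma_op i ` U \<subseteq> U"
proof
  fix y assume "y \<in> sigma_op i ` U"
  then obtain k m where y: "y = sigma_op i (k \<oplus>\<^bsub>D\<^esub> m)" "k \<in> K" "m \<in> L"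
    unfolding U_eq by auto
  then have "k \<in> carrier D" "m \<in> carrier D" by (auto simp: K_eq L_eq)
  then have "y = sigma_op i k \<oplus>\<^bsub>D\<^esub> (c \<odot>\<^bsub>D\<^esub> m)"
    unfolding y(1) using End_memD(3)[OF sigma_op_End[OF i]] sigma_op_on_L[OF y(3) i] by simp
  then show "y \<in> U"
    using U.U_add[OF subsetD[OF K_subset_U sigma_op_on_K[OF y(2) i]]
        U.U_smult[OF subsetD[OF L_subset_U y(3)]], of c] by simp
qed

abbreviation T where "T i \<equiv> KLM n scale l \<rho> (FB_sigma n i)"

lemma KLM_sigma_induced: "i \<in> {1..<n} \<Longrightarrow> T i = U.induced (sigma_op i)"
  unfolding KLM_def U.induced_def KLM_space_def by (simp only: LM_FB_sigma)

section \<open>Eigenvectors that survive in the quotient\<close>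

text \<open>Let \<open>w = k + m\<close> with \<open>k\<close> in \<open>K\<close> and \<open>m\<close> in \<open>L\<close>. Applying \<open>g - 1\<close> to the components removes \<open>k\<close>
  and turns \<open>w\<close> into the nonzero multiple \<open>(\<nu> - 1) w\<close>. As the equations that define \<open>L\<close> are
  preserved by \<open>g - 1\<close>, that multiple, and hence \<open>w\<close>, satisfies them.\<close>

lemma eigenvector_in_U:
  assumes w: "w \<in> U" and eig: "\<And>j. j \<in> {1..n} \<Longrightarrow> g (w j) = \<nu> *s w j" and \<nu>: "\<nu> \<noteq> 1"
  shows "i \<in> {1..<n} \<Longrightarrow> w i = \<nu> *s w (i + 1)"
    and "n = 2 \<Longrightarrow> (l * \<nu>^2) *s w 2 = w 2"
proof -
  from w obtain k m where km: "w = (\<lambda>j. k j + m j)" "k \<in> K" "m \<in> L"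
    unfolding U_eq by blast
  have p: "g (m j) - m j = (\<nu> - 1) *s w j" if "j \<in> {1..n}" for j
  proof -
    have "g (m j) - m j = g (w j) - w j"
      using km that by (simp add: K_eq g.add)
    then show ?thesis using eig[OF that] by (simp add: scale_left_diff_distrib)
  qed
  have cancel: "u = v" if "(\<nu> - 1) *s u = (\<nu> - 1) *s v" for u v
    using that \<nu> by simp
  show "w i = \<nu> *s w (i + 1)" if i: "i \<in> {1..<n}"
  proof (rule cancel)
    have "(\<nu> - 1) *s w i = g (m i) - m i" using p[of i] i by simp
    also have "\<dots> = g (g (m (i + 1)) - m (i + 1))"
      using L_recurrence[OF km(3) i] by (simp add: g.diff)
    also have "\<dots> = (\<nu> - 1) *s (\<nu> *s w (i + 1))"
      using p[of "i + 1"] eig[of "i + 1"] i by (simp add: g.scale)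
    finally show "(\<nu> - 1) *s w i = (\<nu> - 1) *s (\<nu> *s w (i + 1))" .
  qed
  show "(l * \<nu>^2) *s w 2 = w 2" if n2: "n = 2"
  proof (rule cancel)
    have "m 2 = l *s g (g (m 2))" using L_iff_2[OF n2] km(3) by simp
    then have "g (m 2) - m 2 = g (l *s g (g (m 2))) - l *s g (g (m 2))" by simp
    also have "\<dots> = l *s g (g (g (m 2) - m 2))" by (simp add: g.scale g.diff scale_right_diff_distrib)
    also have "\<dots> = (\<nu> - 1) *s ((l * \<nu>^2) *s w 2)"
      using p[of 2] eig[of 2] n2 by (simp add: g.scale power2_eq_square mult_ac)
    finally show "(\<nu> - 1) *s ((l * \<nu>^2) *s w 2) = (\<nu> - 1) *s w 2"
      using p[of 2] n2 by simp
  qed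
qed

text \<open>On the eigenspace of \<open>g\<close> for \<open>\<nu>\<close>, the operator of $\sigma_1$ is \<open>c\<close> times a block with
  characteristic polynomial $(t - 1)(t + \nu)$. The following vector belongs to the eigenvalue
  $-\nu$ of that block.\<close>

definition e1_minus_e2 :: "'v \<Rightarrow> nat \<Rightarrow> 'v"
  where "e1_minus_e2 v = (\<lambda>j. if j = 1 then v else if j = 2 then - v else 0)"

lemma e1_minus_e2_carrier: "e1_minus_e2 v \<in> carrier D"
  using n by (auto simp: e1_minus_e2_def)

text \<open>By the recurrence for \<open>L\<close>, membership would force \<open>\<nu> = - 1\<close>. For \<open>n \<ge> 3\<close> the vanishing third
  component would make \<open>v\<close> zero, and for \<open>n = 2\<close> the resonance condition would become \<open>l = 1\<close>.\<close>

lemma e1_minus_e2_notin_U: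
  assumes v: "v \<noteq> 0" "g v = \<nu> *s v" and \<nu>: "\<nu> \<noteq> 1"
  shows "e1_minus_e2 v \<notin> U"
proof
  assume U: "e1_minus_e2 v \<in> U"
  have eig: "g (e1_minus_e2 v j) = \<nu> *s e1_minus_e2 v j" for j
    using v by (auto simp: e1_minus_e2_def g.zero g.neg)
  note rel = eigenvector_in_U[OF U eig \<nu>]
  have "v = - (\<nu> *s v)"
    using rel(1)[of 1] n by (simp add: e1_minus_e2_def)
  then have "(1 + \<nu>) *s v = 0"
    by (simp add: scale_left_distrib eq_neg_iff_add_eq_0)
  then have "\<nu> = - 1"
    using v by (simp add: add_eq_0_iff)
  show False
  proof (cases "n = 2")
    case True
    then have "(l * \<nu>^2) *s (- v) = - v" using rel(2) by (simp add: e1_minus_e2_def)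
    then have "(l - 1) *s v = 0"
      using \<open>\<nu> = - 1\<close> by (simp add: scale_left_diff_distrib)
    then show False using l v by simp
  next
    case False
    then show False using rel(1)[of 2] n v by (simp add: e1_minus_e2_def)
  qed
qed

lemma sigma_op_e1_minus_e2:
  assumes "g v = \<nu> *s v"
  shows "sigma_op 1 (e1_minus_e2 v) = (\<lambda>j. (- c * \<nu>) *s e1_minus_e2 v j)"
  unfolding sigma_op_apply[OF e1_minus_e2_carrier] using assms
  by (auto simp: e1_minus_e2_def fun_eq_iff g.neg)

text \<open>The eigenvector is one for the eigenvalue \<open>1\<close> of the block if \<open>n = 2\<close>; it lies in \<open>L\<close> exactly in
  the resonant case. If \<open>n \<ge> 3\<close>, then $\sigma_1$ acts by \<open>c\<close> on the third component, and no nonzero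
  vector supported on a single component satisfies the recurrence for \<open>L\<close>.\<close>

lemma eigenvalue_c:
  assumes v: "v \<noteq> 0" "g v = \<nu> *s v" and \<nu>: "\<nu> \<noteq> 1" and nonres: "n \<ge> 3 \<or> l * \<nu>^2 \<noteq> 1"
  shows "\<exists>w\<in>carrier D. w \<notin> U \<and> sigma_op 1 w = (\<lambda>j. c *s w j)"
proof (cases "n = 2")
  case True
  define w where "w = (\<lambda>j. if j = 1 then \<nu> *s v else if j = (2::nat) then v else 0)"
  have wD: "w \<in> carrier D" using n by (auto simp: w_def)
  have "w \<notin> U"
  proof
    assume "w \<in> U"
    moreover have "g (w j) = \<nu> *s w j" for j
      using v by (auto simp: w_def g.zero g.scale)
    ultimately have "(l * \<nu>^2) *s v = v"
      using eigenvector_in_U(2)[of w \<nu>] \<nu> True by (simp add: w_def)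
    then have "(l * \<nu>^2 - 1) *s v = 0" by (simp add: scale_left_diff_distrib)
    then show False using v nonres True by simp
  qed
  moreover have "sigma_op 1 w = (\<lambda>j. c *s w j)"
    unfolding sigma_op_apply[OF wD] using v by (auto simp: w_def)
  ultimately show ?thesis using wD by blast
next
  case False
  then have n3: "n \<ge> 3" using n by simp
  define w where "w = (\<lambda>j. if j = (3::nat) then v else 0)"
  have wD: "w \<in> carrier D" using n3 by (auto simp: w_def)
  have "\<nu> \<noteq> 0" using v spec_nonzero[of \<nu>] by (auto simp: spec_def)
  have "w \<notin> U"
  proof
    assume "w \<in> U"
    moreover have "g (w j) = \<nu> *s w j" for j
      using v by (auto simp: w_def g.zero)
    ultimately have "w 2 = \<nu> *s w 3"
      using eigenvector_in_U(1)[of w \<nu> 2] \<nu> n3 by simp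
    then show False using v \<open>\<nu> \<noteq> 0\<close> by (simp add: w_def)
  qed
  moreover have "sigma_op 1 w = (\<lambda>j. c *s w j)"
    unfolding sigma_op_apply[OF wD] using v by (auto simp: w_def g.zero)
  ultimately show ?thesis using wD by blast
qed

section \<open>Consequences of a quadratic relation\<close>

lemma eigenvalue_is_root:
  assumes quad: "\<And>w. w \<in> carrier D \<Longrightarrow> (r1 * r2) \<odot>\<^bsub>D\<^esub> w \<oplus>\<^bsub>D\<^esub> (- (r1 + r2)) \<odot>\<^bsub>D\<^esub> sigma_op 1 w \<oplus>\<^bsub>D\<^esub> sigma_op 1 (sigma_op 1 w) \<in> U"
    and w: "w \<in> carrier D" "w \<notin> U" "sigma_op 1 w = (\<lambda>j. \<kappa> *s w j)"
  shows "\<kappa> = r1 \<or> \<kappa> = r2"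
proof (rule ccontr)
  assume neq: "\<not> (\<kappa> = r1 \<or> \<kappa> = r2)"
  have "1 \<in> {1..<n}" using n by simp
  have "sigma_op 1 (sigma_op 1 w) = (\<lambda>j. \<kappa> *s \<kappa> *s w j)"
    using End_memD(4)[OF sigma_op_End[OF \<open>1 \<in> {1..<n}\<close>] w(1), of \<kappa>] w(3) by simp
  then have "(\<lambda>j. ((\<kappa> - r1) * (\<kappa> - r2)) *s w j) \<in> U"
    using quad[OF w(1)] unfolding w(3) by (simp add: algebra_simps flip: scale_left_distrib)
  then have "w \<in> U"
    by (rule U_scale_cancel) (use neq in simp)
  then show False using w by blast
qed

text \<open>For \<open>\<nu> = - 1\<close> the block is a nontrivial Jordan block for the eigenvalue \<open>1\<close>. So \<open>c\<close> would be a double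
  root of the quadratic polynomial: applied to an eigenvector \<open>v\<close> in the first component, the
  operator $(T - c)(T - r)$ with $r \ne c$ gives a nonzero multiple of \<open>e1_minus_e2 v\<close>.\<close>

lemma minus_one_notin_spec:
  assumes r: "r1 \<noteq> r2"
    and quad: "\<And>w. w \<in> carrier D \<Longrightarrow> (r1 * r2) \<odot>\<^bsub>D\<^esub> w \<oplus>\<^bsub>D\<^esub> (- (r1 + r2)) \<odot>\<^bsub>D\<^esub> sigma_op 1 w \<oplus>\<^bsub>D\<^esub> sigma_op 1 (sigma_op 1 w) \<in> U"
  shows "- 1 \<notin> spec scale g"
proof
  assume "- 1 \<in> spec scale g"
  then obtain v where v: "v \<noteq> 0" "g v = (- 1) *s v" by (auto simp: spec_def)
  have nU: "e1_minus_e2 v \<notin> U" by (rule e1_minus_e2_notin_U[OF v]) simp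
  have "c = r1 \<or> c = r2"
    using eigenvalue_is_root[OF quad e1_minus_e2_carrier nU] sigma_op_e1_minus_e2[OF v(2)] by simp
  then obtain r where r': "r \<noteq> c" "r1 + r2 = c + r" "r1 * r2 = c * r"
    using r by (metis mult.commute add.commute)
  define w where "w = (\<lambda>j. if j = (1::nat) then v else 0)"
  have wD: "w \<in> carrier D" using n by (auto simp: w_def)
  have sD: "sigma_op 1 w \<in> carrier D" using wD n by (intro End_memD(2)[OF sigma_op_End]) auto
  have s: "sigma_op 1 w = (\<lambda>j. if j = 2 then c *s v else 0)"
    unfolding sigma_op_apply[OF wD] by (auto simp: w_def g.zero)
  have ss: "sigma_op 1 (sigma_op 1 w) = (\<lambda>j. if j = 1 then - ((c * c) *s v) else if j = 2 then (c * c) *s v + (c * c) *s v else 0)"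
    unfolding sigma_op_apply[OF sD] unfolding s using v
    by (auto simp: fun_eq_iff g.zero g.scale g.neg scale_right_distrib)
  have "(r1 * r2) \<odot>\<^bsub>D\<^esub> w \<oplus>\<^bsub>D\<^esub> (- (r1 + r2)) \<odot>\<^bsub>D\<^esub> sigma_op 1 w \<oplus>\<^bsub>D\<^esub> sigma_op 1 (sigma_op 1 w)
      = (\<lambda>j. (c * (r - c)) *s e1_minus_e2 v j)"
    unfolding ss unfolding s r'
    by (auto simp: w_def e1_minus_e2_def fun_eq_iff algebra_simps scale_left_diff_distrib scale_left_distrib)
  then have "(\<lambda>j. (c * (r - c)) *s e1_minus_e2 v j) \<in> U"
    using quad[OF wD] by simp
  then have "e1_minus_e2 v \<in> U"
    by (rule U_scale_cancel) (use r' c in simp)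
  then show False using nU by blast
qed

section \<open>Decompositions along the spectrum\<close>

lemma eigenvector_subspace_UNIV:
  assumes P: "subspace P" and eig: "\<And>v r. r \<in> spec scale g \<Longrightarrow> g v = r *s v \<Longrightarrow> v \<in> P"
  shows "v \<in> P"
proof -
  have "{v. \<exists>r. g v = r *s v} \<subseteq> P"
  proof
    fix v assume "v \<in> {v. \<exists>r. g v = r *s v}"
    then obtain r where r: "g v = r *s v" by blast
    show "v \<in> P"
    proof (cases "v = 0")
      case True
      then show ?thesis using subspace_0[OF P] by simp
    next
      case False
      then show ?thesis using eig[OF _ r] r unfolding spec_def by blast
    qed
  qed
  then have "span {v. \<exists>r. g v = r *s v} \<subseteq> P"
    by (rule span_minimal[OF _ P])
  moreover have "span {v. \<exists>r. g v = r *s v} = UNIV"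
    by (rule semisimple_eigenvectors_span[OF finite_dimensional_vector_space_axioms g_linear g_semisimple])
  ultimately show ?thesis by blast
qed

lemma split_off_fixed:
  assumes P: "subspace P" and eig: "\<And>v r. r \<in> spec scale g \<Longrightarrow> r \<noteq> 1 \<Longrightarrow> g v = r *s v \<Longrightarrow> v \<in> P"
  shows "\<exists>a b. v = a + b \<and> g a = a \<and> b \<in> P"
proof -
  have "v \<in> {a + b | a b. g a = a \<and> b \<in> P}"
  proof (rule eigenvector_subspace_UNIV)
    have "subspace {a. g a = a}"
      by (rule subspaceI) (auto simp: g.zero g.add g.scale)
    from subspace_sums[OF this P] show "subspace {a + b | a b. g a = a \<and> b \<in> P}" by simp
    fix v r assume r: "r \<in> spec scale g" "g v = r *s v"
    show "v \<in> {a + b | a b. g a = a \<and> b \<in> P}"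
    proof (cases "r = 1")
      case True
      then have "v = v + 0 \<and> g v = v \<and> 0 \<in> P" using r subspace_0[OF P] by simp
      then show ?thesis by blast
    next
      case False
      then have "v = 0 + v \<and> g 0 = 0 \<and> v \<in> P" using eig r by (simp add: g.zero)
      then show ?thesis by blast
    qed
  qed
  then show ?thesis by blast
qed

lemma spec_two_values:
  assumes "spec scale g \<subseteq> {1, \<mu>}"
  shows "g (g v - \<mu> *s v) = g v - \<mu> *s v"
proof -
  define q where "q v = g v - \<mu> *s v" for v
  have q: "q 0 = 0" "q (x + y) = q x + q y" "q (a *s x) = a *s q x" for x y a
    by (simp_all add: q_def g.zero g.add g.scale scale_right_distrib scale_right_diff_distrib mult.commute)
  have "v \<in> {v. g (q v) = q v}"
  proof (rule eigenvector_subspace_UNIV)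
    show "subspace {v. g (q v) = q v}"
      by (rule subspaceI) (simp_all add: q g.zero g.add g.scale)
    fix v r assume "r \<in> spec scale g" "g v = r *s v"
    then show "v \<in> {v. g (q v) = q v}"
      using assms by (auto simp: q_def g.scale g.diff g.zero)
  qed
  then show ?thesis by (simp add: q_def)
qed

section \<open>Two eigenvalues give a Hecke representation\<close>

text \<open>On the block, $(M - 1)(M + \mu) = (\mu - g)(M - 1)$ because $M^2 = (1 - g) M + g$. So the values of
  $(\sigma_i - c)(\sigma_i + c\mu)$ have components in the image of \<open>g - \<mu>\<close>, on which \<open>g\<close> is the identity.\<close>

lemma sigma_op_quadratic:
  assumes \<mu>: "spec scale g \<subseteq> {1, \<mu>}" and i: "i \<in> {1..<n}" and w: "w \<in> carrier D"
  shows "sigma_op i (sigma_op i w \<oplus>\<^bsub>D\<^esub> (c * \<mu>) \<odot>\<^bsub>D\<^esub> w) \<oplus>\<^bsub>D\<^esub> (- c) \<odot>\<^bsub>D\<^esub> (sigma_op i w \<oplus>\<^bsub>D\<^esub> (c * \<mu>) \<odot>\<^bsub>D\<^esub> w) \<in> K"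
proof -
  let ?z = "sigma_op i w \<oplus>\<^bsub>D\<^esub> (c * \<mu>) \<odot>\<^bsub>D\<^esub> w"
  let ?y = "sigma_op i ?z \<oplus>\<^bsub>D\<^esub> (- c) \<odot>\<^bsub>D\<^esub> ?z"
  define q where "q v = g v - \<mu> *s v" for v
  have gq: "g (q v) = q v" for v
    unfolding q_def by (rule spec_two_values[OF \<mu>])
  have z: "?z \<in> carrier D"
    by (intro D.a_closed D.smult_closed End_memD(2)[OF sigma_op_End[OF i]] w)
  have y: "?y \<in> carrier D"
    by (intro D.a_closed D.smult_closed End_memD(2)[OF sigma_op_End[OF i]] w)
  define u where "u = (c * c) *s (q (w i) - g (q (w (i + 1))))"
  have "?y = (\<lambda>j. if j = i then u else if j = i + 1 then - u else 0)"
    unfolding sigma_op_apply[OF z] unfolding u_def q_def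
    by (auto simp: fun_eq_iff sigma_op_apply[OF w] g.add g.diff g.scale g.neg
        scale_right_distrib scale_right_diff_distrib algebra_simps)
  moreover have "g u = u"
    unfolding u_def by (simp add: g.scale g.diff gq)
  ultimately show ?thesis
    using y unfolding K_eq by (simp add: g.neg g.zero)
qed

lemma KLM_hecke_typeI:
  assumes \<mu>: "spec scale g \<subseteq> {1, \<mu>}"
  shows "KLM_hecke_type n scale l \<rho> c \<mu>"
proof -
  define E where "E = End Q"
  interpret Q: scalar_module Q
    unfolding KLM_space_def by (rule U.quot_scalar_module)
  interpret E: scalar_algebra E unfolding E_def by (rule Q.End_scalar_algebra)
  have Tcl: "T i \<in> carrier E" if i: "i \<in> {1..<n}" for i
    using U.induced_closed[OF sigma_op_End[OF i] sigma_op_U[OF i]]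
    by (simp only: KLM_sigma_induced[OF i] E_def KLM_space_def)
  have quad: "(T i \<ominus>\<^bsub>E\<^esub> c \<odot>\<^bsub>E\<^esub> \<one>\<^bsub>E\<^esub>) \<otimes>\<^bsub>E\<^esub> (T i \<oplus>\<^bsub>E\<^esub> (c * \<mu>) \<odot>\<^bsub>E\<^esub> \<one>\<^bsub>E\<^esub>) = \<zero>\<^bsub>E\<^esub>" if i: "i \<in> {1..<n}" for i
    unfolding KLM_sigma_induced[OF i] E_def KLM_space_def
    by (rule U.induced_quadratic[OF sigma_op_End[OF i] sigma_op_U[OF i]])
       (rule subsetD[OF K_subset_U sigma_op_quadratic[OF \<mu> i]])
  have Tmult: "T i \<otimes>\<^bsub>E\<^esub> T j = U.induced (sigma_op i \<otimes>\<^bsub>End D\<^esub> sigma_op j)"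
    if i: "i \<in> {1..<n}" and j: "j \<in> {1..<n}" for i j
    unfolding KLM_sigma_induced[OF i] KLM_sigma_induced[OF j] E_def KLM_space_def
    by (rule U.induced_mult[OF sigma_op_End[OF i] sigma_op_U[OF i] sigma_op_End[OF j] sigma_op_U[OF j]])
  interpret ED: scalar_algebra "End D" by (rule D.End_scalar_algebra)
  have Tmult3: "T i \<otimes>\<^bsub>E\<^esub> (T j \<otimes>\<^bsub>E\<^esub> T i) = U.induced (sigma_op i \<otimes>\<^bsub>End D\<^esub> (sigma_op j \<otimes>\<^bsub>End D\<^esub> sigma_op i))"
    if i: "i \<in> {1..<n}" and j: "j \<in> {1..<n}" for i j
  proof -
    have ji: "sigma_op j \<otimes>\<^bsub>End D\<^esub> sigma_op i \<in> carrier (End D)"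
      by (rule ED.m_closed[OF sigma_op_End[OF j] sigma_op_End[OF i]])
    have jiU: "(sigma_op j \<otimes>\<^bsub>End D\<^esub> sigma_op i) ` U \<subseteq> U"
    proof (rule image_subsetI)
      fix u assume u: "u \<in> U"
      then have "(sigma_op j \<otimes>\<^bsub>End D\<^esub> sigma_op i) u = sigma_op j (sigma_op i u)"
        using U.U_subset by (auto simp: compose_eq simp del: dsum_simps)
      then show "(sigma_op j \<otimes>\<^bsub>End D\<^esub> sigma_op i) u \<in> U" using u sigma_op_U[OF i] sigma_op_U[OF j] by blast
    qed
    show ?thesis
      unfolding Tmult[OF j i]
      unfolding KLM_sigma_induced[OF i] E_def KLM_space_def
      by (rule U.induced_mult[OF sigma_op_End[OF i] sigma_op_U[OF i] ji jiU])
  qed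
  define t where "t i = inverse c \<odot>\<^bsub>E\<^esub> T i" for i
  have tcl: "t i \<in> carrier E" if "i \<in> {1..<n}" for i
    unfolding t_def using Tcl[OF that] by simp
  have "\<exists>\<Phi>\<in>alg_hom (hecke_alg n \<mu>) E. \<forall>i\<in>{1..<n}. \<Phi> (hecke_gen n \<mu> i) = t i"
  proof (rule E.hecke_alg_lift[OF tcl])
    fix i j assume ij: "i \<in> {1..<n}" "j \<in> {1..<n}" "i + 2 \<le> j \<or> j + 2 \<le> i"
    have "T i \<otimes>\<^bsub>E\<^esub> T j = T j \<otimes>\<^bsub>E\<^esub> T i"
      unfolding Tmult[OF ij(1,2)] Tmult[OF ij(2,1)] sigma_op_comm[OF ij] ..
    then show "t i \<otimes>\<^bsub>E\<^esub> t j = t j \<otimes>\<^bsub>E\<^esub> t i"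
      unfolding t_def using Tcl[OF ij(1)] Tcl[OF ij(2)]
      by (simp add: E.smult_mult_left E.smult_mult_right)
  next
    fix i assume i: "i \<in> {1..<n}" "i + 1 \<in> {1..<n}"
    have "T i \<otimes>\<^bsub>E\<^esub> (T (i + 1) \<otimes>\<^bsub>E\<^esub> T i) = T (i + 1) \<otimes>\<^bsub>E\<^esub> (T i \<otimes>\<^bsub>E\<^esub> T (i + 1))"
      unfolding Tmult3[OF i] Tmult3[OF i(2,1)] sigma_op_braid[OF i] ..
    then show "t i \<otimes>\<^bsub>E\<^esub> t (i + 1) \<otimes>\<^bsub>E\<^esub> t i = t (i + 1) \<otimes>\<^bsub>E\<^esub> t i \<otimes>\<^bsub>E\<^esub> t (i + 1)"
      unfolding t_def using Tcl[OF i(1)] Tcl[OF i(2)]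
      by (simp add: E.smult_mult_left E.smult_mult_right E.m_assoc)
  next
    fix i assume i: "i \<in> {1..<n}"
    note Ti = Tcl[OF i]
    have 1: "t i \<ominus>\<^bsub>E\<^esub> \<one>\<^bsub>E\<^esub> = inverse c \<odot>\<^bsub>E\<^esub> (T i \<ominus>\<^bsub>E\<^esub> c \<odot>\<^bsub>E\<^esub> \<one>\<^bsub>E\<^esub>)"
      unfolding t_def using Ti c
      by (simp add: a_minus_def E.smult_r_distr E.smult_minus_right flip: E.smult_assoc)
    have 2: "t i \<oplus>\<^bsub>E\<^esub> \<mu> \<odot>\<^bsub>E\<^esub> \<one>\<^bsub>E\<^esub> = inverse c \<odot>\<^bsub>E\<^esub> (T i \<oplus>\<^bsub>E\<^esub> (c * \<mu>) \<odot>\<^bsub>E\<^esub> \<one>\<^bsub>E\<^esub>)"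
      unfolding t_def using Ti c
      by (simp add: E.smult_r_distr flip: E.smult_assoc mult.assoc)
    show "(t i \<ominus>\<^bsub>E\<^esub> \<one>\<^bsub>E\<^esub>) \<otimes>\<^bsub>E\<^esub> (t i \<oplus>\<^bsub>E\<^esub> \<mu> \<odot>\<^bsub>E\<^esub> \<one>\<^bsub>E\<^esub>) = \<zero>\<^bsub>E\<^esub>"
      unfolding 1 2 using Ti quad[OF i]
      by (simp add: E.smult_mult_left E.smult_mult_right)
  qed
  then show ?thesis
    unfolding KLM_hecke_type_def Let_def
    using Tcl quad unfolding E_def t_def by blast
qed

section \<open>The spectrum forced by a quadratic minimal polynomial\<close>

lemma quadratic_minpoly_sigma_op_iff:
  "quadratic_minpoly_distinct_roots (End Q) (T 1) \<longleftrightarrow>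
    (\<exists>r1 r2. r1 \<noteq> r2 \<and>
       (\<forall>w\<in>carrier D. (r1 * r2) \<odot>\<^bsub>D\<^esub> w \<oplus>\<^bsub>D\<^esub> (- (r1 + r2)) \<odot>\<^bsub>D\<^esub> sigma_op 1 w \<oplus>\<^bsub>D\<^esub> sigma_op 1 (sigma_op 1 w) \<in> U) \<and>
       \<not> (\<exists>r. \<forall>w\<in>carrier D. sigma_op 1 w \<oplus>\<^bsub>D\<^esub> (- r) \<odot>\<^bsub>D\<^esub> w \<in> U))"
proof -
  have i: "1 \<in> {1..<n}" using n by simp
  show ?thesis
    using U.quadratic_minpoly_induced_iff[OF sigma_op_End[OF i] sigma_op_U[OF i]]
    by (simp only: KLM_sigma_induced[OF i] KLM_space_def)
qed

text \<open>Every eigenvalue \<open>\<nu> \<noteq> 1\<close> of \<open>g\<close> contributes the root \<open>- c \<nu>\<close>, which differs from \<open>c\<close>, and a nonresonant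
  one contributes the root \<open>c\<close> as well. Two roots leave room for one \<open>\<nu>\<close> only, unless all of
  them are resonant. In that case they are among \<open>\<nu>\<^sub>0\<close> and \<open>- \<nu>\<^sub>0\<close>, and both occur because
  the operator would be a scalar otherwise.\<close>

lemma spec_of_quadratic:
  assumes "quadratic_minpoly_distinct_roots (End Q) (T 1)"
  shows "(n \<ge> 3 \<or> (\<forall>\<nu>\<in>spec scale g. l * \<nu>^2 \<noteq> 1) \<longrightarrow>
        (\<exists>\<mu>. \<mu> \<noteq> 0 \<and> \<mu> \<notin> {1, -1} \<and> spec scale g \<subseteq> {1, \<mu>})) \<and>
      (n = 2 \<and> (\<exists>\<nu>\<^sub>0\<in>spec scale g. l * \<nu>\<^sub>0^2 = 1) \<longrightarrow>
        (\<exists>\<nu>. \<nu> \<noteq> 0 \<and> spec scale g - {1} = {\<nu>, -\<nu>} \<and> l = inverse (\<nu>^2)))"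
proof -
  from assms obtain r1 r2 where r: "r1 \<noteq> r2"
    and quad: "\<And>w. w \<in> carrier D \<Longrightarrow> (r1 * r2) \<odot>\<^bsub>D\<^esub> w \<oplus>\<^bsub>D\<^esub> (- (r1 + r2)) \<odot>\<^bsub>D\<^esub> sigma_op 1 w \<oplus>\<^bsub>D\<^esub> sigma_op 1 (sigma_op 1 w) \<in> U"
    and nscalar: "\<And>r. \<exists>w\<in>carrier D. sigma_op 1 w \<oplus>\<^bsub>D\<^esub> (- r) \<odot>\<^bsub>D\<^esub> w \<notin> U"
    unfolding quadratic_minpoly_sigma_op_iff by blast
  have i: "1 \<in> {1..<n}" using n by simp
  have m1: "- 1 \<notin> spec scale g" by (rule minus_one_notin_spec[OF r quad])
  have root: "- c * \<nu> = r1 \<or> - c * \<nu> = r2" if \<nu>: "\<nu> \<in> spec scale g" "\<nu> \<noteq> 1" for \<nu>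
  proof -
    obtain v where v: "v \<noteq> 0" "g v = \<nu> *s v" using \<nu>(1) by (auto simp: spec_def)
    show ?thesis
      by (rule eigenvalue_is_root[OF quad e1_minus_e2_carrier e1_minus_e2_notin_U[OF v \<nu>(2)] sigma_op_e1_minus_e2[OF v(2)]])
  qed
  have root_c: "c = r1 \<or> c = r2" if \<nu>: "\<nu> \<in> spec scale g" "\<nu> \<noteq> 1" "n \<ge> 3 \<or> l * \<nu>^2 \<noteq> 1" for \<nu>
  proof -
    obtain v where v: "v \<noteq> 0" "g v = \<nu> *s v" using \<nu>(1) by (auto simp: spec_def)
    show ?thesis
      using eigenvalue_c[OF v \<nu>(2,3)] eigenvalue_is_root[OF quad] by blast
  qed
  have unique: "\<nu> = \<nu>'" if "\<nu> \<in> spec scale g" "\<nu> \<noteq> 1" "\<nu>' \<in> spec scale g" "\<nu>' \<noteq> 1"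
    "n \<ge> 3 \<or> l * \<nu>^2 \<noteq> 1" for \<nu> \<nu>'
  proof -
    have neq: "- c * \<kappa> \<noteq> c" if "\<kappa> \<in> spec scale g" for \<kappa>
    proof
      assume "- c * \<kappa> = c"
      then have "c * \<kappa> = - c" by (metis minus_minus mult_minus_left)
      then have "c * (\<kappa> + 1) = 0" by (simp add: distrib_left)
      then have "\<kappa> = - 1" using c by (simp add: eq_neg_iff_add_eq_0)
      then show False using m1 that by blast
    qed
    have "- c * \<nu> = - c * \<nu>'"
      using root[OF that(1,2)] root[OF that(3,4)] root_c[OF that(1,2,5)] neq[OF that(1)] neq[OF that(3)]
      by argo
    then show ?thesis using c by simp
  qed
  \<comment> \<open>If \<open>\<nu>0\<close> were the only eigenvalue besides \<open>1\<close>, then $T + c\nu_0$ would map into \<open>K + L\<close>: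
    its values are, up to \<open>K\<close>, of the form \<open>(g z, z)\<close> with \<open>g z = \<nu>0 *s z\<close>, and these lie in \<open>L\<close>.\<close>
  have nonscalar: "\<exists>\<nu>\<in>spec scale g. \<nu> \<noteq> 1 \<and> \<nu> \<noteq> \<nu>0" if \<nu>0: "n = 2" "l * \<nu>0^2 = 1" for \<nu>0
  proof (rule ccontr)
    assume "\<not> ?thesis"
    then have sp: "\<nu> = \<nu>0" if "\<nu> \<in> spec scale g" "\<nu> \<noteq> 1" for \<nu> using that by blast
    have "sigma_op 1 w \<oplus>\<^bsub>D\<^esub> (- (- c * \<nu>0)) \<odot>\<^bsub>D\<^esub> w \<in> U" if w: "w \<in> carrier D" for w
    proof -
      have "subspace {v. g v = \<nu>0 *s v}"
        by (rule subspaceI) (auto simp: g.zero g.add g.scale scale_right_distrib)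
      note dec = split_off_fixed[OF this]
      obtain a1 a2 where a: "w 1 = a1 + a2" "g a1 = a1" "g a2 = \<nu>0 *s a2"
        using dec[of "w 1"] sp by auto
      obtain b1 b2 where b: "w 2 = b1 + b2" "g b1 = b1" "g b2 = \<nu>0 *s b2"
        using dec[of "w 2"] sp by auto
      define z where "z = c *s (a2 + b2)"
      define m where "m = (\<lambda>j. if j = 1 then g z else if j = (2::nat) then z else 0)"
      define k where "k = (\<lambda>j. if j = 1 then c *s (b1 + \<nu>0 *s a1) else if j = (2::nat) then c *s (a1 + \<nu>0 *s b1) else 0)"
      have gz: "g z = \<nu>0 *s z"
        using a b by (simp add: z_def g.scale g.add scale_right_distrib mult.commute)
      have "m \<in> L"
        unfolding L_iff_2[OF \<nu>0(1)] using \<nu>0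
        by (auto simp: m_def gz g.scale power2_eq_square mult.assoc)
      moreover have "k \<in> K"
        unfolding K_eq using \<nu>0 a b by (auto simp: k_def g.scale g.add g.zero)
      moreover have "sigma_op 1 w \<oplus>\<^bsub>D\<^esub> (- (- c * \<nu>0)) \<odot>\<^bsub>D\<^esub> w = (\<lambda>j. k j + m j)"
        using w \<nu>0 a b unfolding sigma_op_apply[OF w]
        by (auto simp: fun_eq_iff k_def m_def z_def numeral_2_eq_2[symmetric] g.add g.scale
            scale_right_distrib scale_right_diff_distrib algebra_simps)
      ultimately show ?thesis by (simp only: U_I)
    qed
    then show False using nscalar[of "- c * \<nu>0"] by blast
  qed
  have nonempty: "\<exists>\<nu>\<in>spec scale g. \<nu> \<noteq> 1"
  proof (rule ccontr)
    assume "\<not> ?thesis"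
    then have "g v = v" for v
      using eigenvector_subspace_UNIV[of "{v. g v = v}"]
      by (force intro!: subspaceI simp: g.zero g.add g.scale)
    then have "carrier D \<subseteq> U" using K_subset_U by (auto simp: K_eq)
    moreover have "sigma_op 1 w \<oplus>\<^bsub>D\<^esub> (- 0) \<odot>\<^bsub>D\<^esub> w \<in> carrier D" if "w \<in> carrier D" for w
      by (intro D.a_closed D.smult_closed End_memD(2)[OF sigma_op_End[OF i]] that)
    ultimately show False
      using nscalar[of 0] by (meson subsetD)
  qed
  show ?thesis
  proof (intro conjI impI)
    assume nonres: "n \<ge> 3 \<or> (\<forall>\<nu>\<in>spec scale g. l * \<nu>^2 \<noteq> 1)"
    from nonempty obtain \<mu> where \<mu>: "\<mu> \<in> spec scale g" "\<mu> \<noteq> 1" by blast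
    have "spec scale g \<subseteq> {1, \<mu>}"
      using unique \<mu> nonres by blast
    then show "\<exists>\<mu>. \<mu> \<noteq> 0 \<and> \<mu> \<notin> {1, -1} \<and> spec scale g \<subseteq> {1, \<mu>}"
      using \<mu> m1 spec_nonzero[OF \<mu>(1)] by blast
  next
    assume res: "n = 2 \<and> (\<exists>\<nu>\<^sub>0\<in>spec scale g. l * \<nu>\<^sub>0^2 = 1)"
    then obtain \<nu>0 where \<nu>0: "\<nu>0 \<in> spec scale g" "l * \<nu>0^2 = 1" by blast
    have "\<nu>0 \<noteq> 1" using \<nu>0 l by auto
    have all_res: "\<nu> = \<nu>0 \<or> \<nu> = - \<nu>0" if \<nu>: "\<nu> \<in> spec scale g" "\<nu> \<noteq> 1" for \<nu>
    proof (cases "l * \<nu>^2 = 1")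
      case True
      then have "\<nu>^2 = \<nu>0^2" using \<nu>0 l by (metis mult_left_cancel)
      then show ?thesis by (simp add: power2_eq_iff)
    next
      case False
      then show ?thesis using unique[OF \<nu> \<nu>0(1) \<open>\<nu>0 \<noteq> 1\<close>] by blast
    qed
    obtain \<nu> where \<nu>: "\<nu> \<in> spec scale g" "\<nu> \<noteq> 1" "\<nu> \<noteq> \<nu>0"
      using nonscalar[OF _ \<nu>0(2)] res by blast
    have \<nu>_eq: "\<nu> = - \<nu>0" using all_res[OF \<nu>(1,2)] \<nu>(3) by simp
    have "spec scale g - {1} = {\<nu>0, - \<nu>0}"
    proof
      show "spec scale g - {1} \<subseteq> {\<nu>0, - \<nu>0}" using all_res by auto
      show "{\<nu>0, - \<nu>0} \<subseteq> spec scale g - {1}"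
        using \<nu>(1,2) \<nu>0(1) \<open>\<nu>0 \<noteq> 1\<close> unfolding \<nu>_eq by simp
    qed
    moreover have "l = inverse (\<nu>0^2)"
      using inverse_unique[of "\<nu>0^2" l] \<nu>0(2) by (simp add: mult.commute)
    ultimately show "\<exists>\<nu>. \<nu> \<noteq> 0 \<and> spec scale g - {1} = {\<nu>, -\<nu>} \<and> l = inverse (\<nu>^2)"
      using spec_nonzero[OF \<nu>0(1)] by blast
  qed
qed

text \<open>On the sum \<open>V'\<close> of the eigenspaces for \<open>\<nu>\<close> and \<open>- \<nu>\<close> one has \<open>l *s g (g v) = v\<close>, so that each pair
  \<open>(g z, z)\<close> with \<open>z\<close> in \<open>V'\<close> lies in \<open>L\<close>, and $T^2 - c^2 \nu^2$ takes values of this form up to \<open>K\<close>.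
  The roots \<open>c \<nu>\<close> and \<open>- c \<nu>\<close> both have eigenvectors that survive in the quotient.\<close>

lemma quadratic_of_resonant:
  assumes n2: "n = 2" and \<nu>: "spec scale g - {1} = {\<nu>, - \<nu>}" "l = inverse (\<nu>^2)"
  shows "quadratic_minpoly_distinct_roots (End Q) (T 1)"
proof -
  have sp: "\<nu> \<in> spec scale g" "- \<nu> \<in> spec scale g" "\<nu> \<noteq> 1" "- \<nu> \<noteq> 1" using \<nu> by blast+
  have "\<nu> \<noteq> 0" using spec_nonzero sp by blast
  have l\<nu>: "l * \<nu>^2 = 1" using \<nu>(2) \<open>\<nu> \<noteq> 0\<close> by simp
  have "(c * \<nu> * (- c * \<nu>)) \<odot>\<^bsub>D\<^esub> w \<oplus>\<^bsub>D\<^esub> (- (c * \<nu> + (- c * \<nu>))) \<odot>\<^bsub>D\<^esub> sigma_op 1 w \<oplus>\<^bsub>D\<^esub> sigma_op 1 (sigma_op 1 w) \<in> U"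
    if w: "w \<in> carrier D" for w
  proof -
    have sD: "sigma_op 1 w \<in> carrier D" using w n by (intro End_memD(2)[OF sigma_op_End]) auto
    have w0: "w j = 0" if "j \<noteq> 1" "j \<noteq> 2" for j
      using w n2 that by auto
    have "subspace {v. g (g v) = \<nu>^2 *s v}"
      by (rule subspaceI) (auto simp: g.zero g.add g.scale scale_right_distrib mult.commute)
    note dec = split_off_fixed[OF this]
    have eig: "g (g v) = \<nu>^2 *s v" if "r \<in> spec scale g" "r \<noteq> 1" "g v = r *s v" for v r
    proof -
      have "r = \<nu> \<or> r = - \<nu>" using that(1,2) \<nu>(1) by blast
      then have "r * r = \<nu>^2" by (auto simp: power2_eq_square)
      then show ?thesis using that(3) by (simp add: g.scale)
    qed
    obtain a1 a2 where a: "w 1 = a1 + a2" "g a1 = a1" "g (g a2) = \<nu>^2 *s a2"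
      using dec[of "w 1"] eig by auto
    obtain b1 b2 where b: "w 2 = b1 + b2" "g b1 = b1" "g (g b2) = \<nu>^2 *s b2"
      using dec[of "w 2"] eig by auto
    define z where "z = (c * c) *s (a2 + b2 - g (a2 + b2))"
    define m where "m = (\<lambda>j. if j = 1 then g z else if j = (2::nat) then z else 0)"
    define k where "k = (\<lambda>j. if j = 1 then (c * c) *s (a1 - \<nu>^2 *s a1)
        else if j = (2::nat) then (c * c) *s (b1 - \<nu>^2 *s b1) else 0)"
    have gz: "g (g z) = \<nu>^2 *s z"
      using a b by (simp add: z_def g.scale g.add g.diff scale_right_distrib scale_right_diff_distrib
          mult.commute)
    have "m \<in> L"
      unfolding L_iff_2[OF n2] using n2 l\<nu> by (auto simp: m_def gz)
    moreover have "k \<in> K"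
      unfolding K_eq using n2 a b by (auto simp: k_def g.scale g.diff g.zero)
    moreover have "(c * \<nu> * (- c * \<nu>)) \<odot>\<^bsub>D\<^esub> w \<oplus>\<^bsub>D\<^esub> (- (c * \<nu> + (- c * \<nu>))) \<odot>\<^bsub>D\<^esub> sigma_op 1 w \<oplus>\<^bsub>D\<^esub> sigma_op 1 (sigma_op 1 w)
        = (\<lambda>j. k j + m j)"
      unfolding sigma_op_apply[OF sD] unfolding sigma_op_apply[OF w] using w0 a b
      by (auto simp: fun_eq_iff k_def m_def z_def numeral_2_eq_2[symmetric] g.add g.scale g.diff
          scale_right_distrib scale_right_diff_distrib algebra_simps power2_eq_square)
    ultimately show ?thesis by (simp only: U_I)
  qed
  moreover have "\<not> (\<forall>w\<in>carrier D. sigma_op 1 w \<oplus>\<^bsub>D\<^esub> (- r) \<odot>\<^bsub>D\<^esub> w \<in> U)" for r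
  proof
    assume scal: "\<forall>w\<in>carrier D. sigma_op 1 w \<oplus>\<^bsub>D\<^esub> (- r) \<odot>\<^bsub>D\<^esub> w \<in> U"
    have "- c * \<kappa> = r" if \<kappa>: "\<kappa> \<in> spec scale g" "\<kappa> \<noteq> 1" for \<kappa>
    proof (rule ccontr)
      assume neq: "- c * \<kappa> \<noteq> r"
      obtain v where v: "v \<noteq> 0" "g v = \<kappa> *s v" using \<kappa>(1) by (auto simp: spec_def)
      have "(\<lambda>j. (- c * \<kappa> + - r) *s e1_minus_e2 v j) \<in> U"
        using bspec[OF scal e1_minus_e2_carrier[of v]] unfolding sigma_op_e1_minus_e2[OF v(2)]
        by (simp only: dsum_simps scale_left_distrib)
      then have "e1_minus_e2 v \<in> U"
        by (rule U_scale_cancel) (use neq in simp)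
      then show False using e1_minus_e2_notin_U[OF v \<kappa>(2)] by blast
    qed
    from this[OF sp(1,3)] this[OF sp(2,4)] have "2 * (c * \<nu>) = 0" by (simp add: algebra_simps)
    then show False using c \<open>\<nu> \<noteq> 0\<close> by simp
  qed
  moreover have "c * \<nu> \<noteq> - c * \<nu>"
    using c \<open>\<nu> \<noteq> 0\<close> by (simp add: eq_neg_iff_add_eq_0 flip: mult_2)
  ultimately show ?thesis
    unfolding quadratic_minpoly_sigma_op_iff by blast
qed

end

theorem theorem1p2:
  fixes scale :: "'k::{alg_closed_field, field_char_0} \<Rightarrow> 'v::ab_group_add \<Rightarrow> 'v"
    and Basis :: "'v set" and n :: nat and g :: "'v \<Rightarrow> 'v" and c :: 'k
    and \<rho> :: "fb \<Rightarrow> 'v \<Rightarrow> 'v"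
  assumes V: "finite_dimensional_vector_space scale Basis"
    and n: "n \<ge> 2"
    and g: "g \<in> carrier (GL (vspace scale))" "semisimple_op scale g"
    and c: "c \<noteq> 0"
    and \<rho>: "\<rho> \<in> hom (FB n) (GL (vspace scale))"
    and \<rho>_x: "\<And>j. j \<in> {1..n} \<Longrightarrow> \<rho> (FB_x n j) = g"
    and \<rho>_sigma: "\<And>i. i \<in> {1..<n} \<Longrightarrow> \<rho> (FB_sigma n i) = scale c"
  shows
    "(\<forall>l \<mu>. l \<noteq> 0 \<and> l \<noteq> 1 \<and> \<mu> \<noteq> 0 \<and> \<mu> \<notin> {1, -1} \<and> spec scale g \<subseteq> {1, \<mu>} \<longrightarrow>
        KLM_hecke_type n scale l \<rho> c \<mu>)
    \<and>
    (\<forall>l. l \<noteq> 0 \<and> l \<noteq> 1 \<and>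
        carrier (KLM_space n scale l \<rho>) \<noteq> {\<zero>\<^bsub>KLM_space n scale l \<rho>\<^esub>} \<and>
        (\<forall>i\<in>{1..<n}. quadratic_minpoly_distinct_roots
           (End (KLM_space n scale l \<rho>)) (KLM n scale l \<rho> (FB_sigma n i))) \<longrightarrow>
      (n \<ge> 3 \<longrightarrow>
        (\<exists>\<mu>. \<mu> \<noteq> 0 \<and> \<mu> \<notin> {1, -1} \<and> spec scale g \<subseteq> {1, \<mu>} \<and>
          (\<forall>l'. l' \<noteq> 0 \<and> l' \<noteq> 1 \<longrightarrow> KLM_hecke_type n scale l' \<rho> c \<mu>))) \<and>
      (n = 2 \<and> (\<forall>\<nu>\<in>spec scale g. l * \<nu>^2 \<noteq> 1) \<longrightarrow>
        (\<exists>\<mu>. \<mu> \<noteq> 0 \<and> \<mu> \<notin> {1, -1} \<and> spec scale g \<subseteq> {1, \<mu>} \<and>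
          (\<forall>l'. l' \<noteq> 0 \<and> l' \<noteq> 1 \<longrightarrow> KLM_hecke_type n scale l' \<rho> c \<mu>))) \<and>
      (n = 2 \<and> (\<exists>\<nu>\<^sub>0\<in>spec scale g. l * \<nu>\<^sub>0^2 = 1) \<longrightarrow>
        (\<exists>\<nu>. \<nu> \<noteq> 0 \<and> spec scale g - {1} = {\<nu>, -\<nu>} \<and> l = inverse (\<nu>^2))))
    \<and>
    (n = 2 \<longrightarrow>
      (\<forall>l \<nu>. \<nu> \<noteq> 0 \<and> spec scale g - {1} = {\<nu>, -\<nu>} \<and> l = inverse (\<nu>^2) \<and> l \<noteq> 1 \<longrightarrow>
        quadratic_minpoly_distinct_roots
          (End (KLM_space n scale l \<rho>)) (KLM n scale l \<rho> (FB_sigma n 1))))"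
proof -
  have rep: "scalar_rep scale Basis n g c \<rho> l" if "l \<noteq> 0" "l \<noteq> 1" for l
    by (intro scalar_rep.intro scalar_rep_axioms.intro) (use assms that in auto)
  have hecke: "KLM_hecke_type n scale l \<rho> c \<mu>"
    if "l \<noteq> 0" "l \<noteq> 1" "spec scale g \<subseteq> {1, \<mu>}" for l \<mu>
    using scalar_rep.KLM_hecke_typeI[OF rep[OF that(1,2)] that(3)] .
  have one: "1 \<in> {1..<n}" using n by simp
  show ?thesis
  proof (intro conjI allI impI; elim conjE)
    fix l
    assume "l \<noteq> 0" "l \<noteq> 1" and quad: "\<forall>i\<in>{1..<n}. quadratic_minpoly_distinct_roots
           (End (KLM_space n scale l \<rho>)) (KLM n scale l \<rho> (FB_sigma n i))"
    note spec = scalar_rep.spec_of_quadratic[OF rep[OF \<open>l \<noteq> 0\<close> \<open>l \<noteq> 1\<close>] bspec[OF quad one]]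
    show "\<exists>\<mu>. \<mu> \<noteq> 0 \<and> \<mu> \<notin> {1, -1} \<and> spec scale g \<subseteq> {1, \<mu>} \<and>
        (\<forall>l'. l' \<noteq> 0 \<and> l' \<noteq> 1 \<longrightarrow> KLM_hecke_type n scale l' \<rho> c \<mu>)" if "n \<ge> 3"
      using spec that hecke by meson
    show "\<exists>\<mu>. \<mu> \<noteq> 0 \<and> \<mu> \<notin> {1, -1} \<and> spec scale g \<subseteq> {1, \<mu>} \<and>
        (\<forall>l'. l' \<noteq> 0 \<and> l' \<noteq> 1 \<longrightarrow> KLM_hecke_type n scale l' \<rho> c \<mu>)"
      if "n = 2" "\<forall>\<nu>\<in>spec scale g. l * \<nu>^2 \<noteq> 1"
      using spec that hecke by meson
    show "\<exists>\<nu>. \<nu> \<noteq> 0 \<and> spec scale g - {1} = {\<nu>, -\<nu>} \<and> l = inverse (\<nu>^2)"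
      if "n = 2" "\<exists>\<nu>\<^sub>0\<in>spec scale g. l * \<nu>\<^sub>0^2 = 1"
      using spec that by blast
  next
    fix l \<nu> assume "n = 2" "\<nu> \<noteq> 0" "spec scale g - {1} = {\<nu>, -\<nu>}" "l = inverse (\<nu>^2)" "l \<noteq> 1"
    then show "quadratic_minpoly_distinct_roots
        (End (KLM_space n scale l \<rho>)) (KLM n scale l \<rho> (FB_sigma n 1))"
      using scalar_rep.quadratic_of_resonant[OF rep] by simp
  qed (rule hecke)
qed

end
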